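(* Suppose given a recollement of triangulated categories with $i\colon\mathcal{N}\hookrightarrow\mathcal{C}$, $\ell\colon\mathcal{C}\to\mathcal{C}_{\mathcal{N}}$, adjoints $i^{\ast}\dashv i\dashv i^{!}$ and $j_!\dashv\ell\dashv j_{\ast}$, and let $(\mathcal{S},\mathcal{V})$ be any cotorsion pair on $\mathcal{N}$. Put $\mathcal{U}=(i^{\ast})^{-1}(\mathcal{S})$ and $\mathcal{T}=(i^{!})^{-1}(\mathcal{V})$ (full subcategories of $\mathcal{C}$). Then $\mathcal{P}=((\mathcal{S},\mathcal{T}),(\mathcal{U},\mathcal{V}))$ is a Hovey twin cotorsion pair on $\mathcal{C}$. In particular, $\mathcal{U}={}^{\perp}\mathcal{V}[1]$ and $\mathcal{T}=\mathcal{S}[-1]^{\perp}$, orthogonals being taken in $\mathcal{C}$.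
   Context: For a triangulated category $\mathcal{C}$ with shift $[1]$, $\mathrm{Ext}^1_{\mathcal{C}}(X,Y)=\mathcal{C}(X,Y[1])$. For full subcategories $\mathcal{X},\mathcal{Y}\subseteq\mathcal{C}$, $\mathcal{X}\ast\mathcal{Y}$ is the full subcategory of objects $C$ admitting a distinguished triangle $X\to C\to Y\to X[1]$ with $X\in\mathcal{X},Y\in\mathcal{Y}$. A cotorsion pair on $\mathcal{C}$ is a pair $(\mathcal{U},\mathcal{V})$ of full additive subcategories closed under isomorphisms and direct summands with $\mathcal{C}=\mathcal{U}\ast\mathcal{V}[1]$ and $\mathrm{Ext}^1_{\mathcal{C}}(\mathcal{U},\mathcal{V})=0$. A twin cotorsion pair (TCP) on $\mathcal{C}$ is a pair $((\mathcal{S},\mathcal{T}),(\mathcal{U},\mathcal{V}))$ of cotorsion pairs on $\mathcal{C}$ with $\mathrm{Ext}^1_{\mathcal{C}}(\mathcal{S},\mathcal{V})=0$. It is a Hovey TCP if $\mathcal{S}\ast\mathcal{V}[1]=\mathcal{S}[-1]\ast\mathcal{V}$. Also $\mathcal{S}[-1]^{\perp}=\{C\in\mathcal{C}\mid\mathcal{C}(\mathcal{S}[-1],C)=0\}$ and ${}^{\perp}\mathcal{V}[1]=\{C\in\mathcal{C}\mid\mathcal{C}(C,\mathcal{V}[1])=0\}$. Recollement: $\mathcal{N}$ is a full triangulated subcategory of $\mathcal{C}$ closed under isomorphisms with inclusion $i$, $\ell\colon\mathcal{C}\to\mathcal{C}_{\mathcal{N}}$ is the Verdier quotient, all functors $i,i^{\ast},i^!,\ell,j_!,j_{\ast}$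 are triangle functors, $i^{\ast}\dashv i\dashv i^!$ and $j_!\dashv\ell\dashv j_{\ast}$, the functors $i,j_!,j_{\ast}$ are fully faithful, $\ell\circ i=0$, and for every $C\in\mathcal{C}$ the units and counits give distinguished triangles $ii^!C\to C\to j_{\ast}\ell C\to(ii^!C)[1]$ and $j_!\ell C\to C\to ii^{\ast}C\to(j_!\ell C)[1]$. *)

theory Defs
  imports "HOL-Algebra.Group"
begin

section \<open>Additive categories and functors\<close>

record ('o, 'm, 'p, 'n) ftor =
  FO :: "'o \<Rightarrow> 'p"
  FM :: "'m \<Rightarrow> 'n"

text \<open>
  A category (with additive structure and a shift) has its objects in a set over \<open>'o\<close> and
  its morphisms in \<open>'m\<close>; every morphism determines its domain and codomain.
\<close>

record ('o, 'm) shift_category =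
  Obj :: "'o set"
  Hom :: "'o \<Rightarrow> 'o \<Rightarrow> 'm set"
  Id :: "'o \<Rightarrow> 'm"
  Comp :: "'m \<Rightarrow> 'm \<Rightarrow> 'm"  (infixl "\<bullet>\<index>" 70)
  Add :: "'m \<Rightarrow> 'm \<Rightarrow> 'm"
  Zero :: "'o \<Rightarrow> 'o \<Rightarrow> 'm"
  Shift :: "('o, 'm, 'o, 'm) ftor"

abbreviation ShO :: "('o, 'm, 'z) shift_category_scheme \<Rightarrow> 'o \<Rightarrow> 'o"
  where "ShO C \<equiv> FO (Shift C)"

abbreviation ShM :: "('o, 'm, 'z) shift_category_scheme \<Rightarrow> 'm \<Rightarrow> 'm"
  where "ShM C \<equiv> FM (Shift C)"

locale category =
  fixes C :: "('o, 'm, 'z) shift_category_scheme" (structure)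
  assumes Hom_Obj: "f \<in> Hom C A B \<Longrightarrow> A \<in> Obj C \<and> B \<in> Obj C"
    and Hom_disjoint: "f \<in> Hom C A B \<Longrightarrow> f \<in> Hom C A' B' \<Longrightarrow> A = A' \<and> B = B'"
    and Id_Hom: "A \<in> Obj C \<Longrightarrow> Id C A \<in> Hom C A A"
    and Comp_Hom: "f \<in> Hom C A B \<Longrightarrow> g \<in> Hom C B D \<Longrightarrow> g \<bullet> f \<in> Hom C A D"
    and Id_left: "f \<in> Hom C A B \<Longrightarrow> Id C B \<bullet> f = f"
    and Id_right: "f \<in> Hom C A B \<Longrightarrow> f \<bullet> Id C A = f"
    and Comp_assoc: "f \<in> Hom C A B \<Longrightarrow> g \<in> Hom C B D \<Longrightarrow> h \<in> Hom C D E
          \<Longrightarrow> (h \<bullet> g) \<bullet> f = h \<bullet> (g \<bullet> f)"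

definition is_iso :: "('o, 'm, 'z) shift_category_scheme \<Rightarrow> 'o \<Rightarrow> 'o \<Rightarrow> 'm \<Rightarrow> bool" where
  "is_iso C A B f \<longleftrightarrow> f \<in> Hom C A B \<and>
     (\<exists>g \<in> Hom C B A. g \<bullet>\<^bsub>C\<^esub> f = Id C A \<and> f \<bullet>\<^bsub>C\<^esub> g = Id C B)"

definition iso_objects :: "('o, 'm, 'z) shift_category_scheme \<Rightarrow> 'o \<Rightarrow> 'o \<Rightarrow> bool" where
  "iso_objects C A B \<longleftrightarrow> (\<exists>f. is_iso C A B f)"

definition hom_group :: "('o, 'm, 'z) shift_category_scheme \<Rightarrow> 'o \<Rightarrow> 'o \<Rightarrow> 'm monoid" where
  "hom_group C A B = \<lparr>carrier = Hom C A B, mult = Add C, one = Zero C A B\<rparr>"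

abbreviation Neg :: "('o, 'm, 'z) shift_category_scheme \<Rightarrow> 'o \<Rightarrow> 'o \<Rightarrow> 'm \<Rightarrow> 'm" where
  "Neg C A B f \<equiv> inv\<^bsub>hom_group C A B\<^esub> f"

definition zero_object :: "('o, 'm, 'z) shift_category_scheme \<Rightarrow> 'o \<Rightarrow> bool" where
  "zero_object C Z \<longleftrightarrow> Z \<in> Obj C \<and>
     (\<forall>A \<in> Obj C. (\<exists>!f. f \<in> Hom C A Z) \<and> (\<exists>!f. f \<in> Hom C Z A))"

definition is_biproduct :: "('o, 'm, 'z) shift_category_scheme \<Rightarrow> 'o \<Rightarrow> 'o \<Rightarrow> 'o \<Rightarrow> bool" where
  "is_biproduct C A B P \<longleftrightarrow> (\<exists>i1 \<in> Hom C A P. \<exists>i2 \<in> Hom C B P. \<exists>p1 \<in> Hom C P A. \<exists>p2 \<in> Hom C P B.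
     p1 \<bullet>\<^bsub>C\<^esub> i1 = Id C A \<and> p2 \<bullet>\<^bsub>C\<^esub> i2 = Id C B \<and>
     p2 \<bullet>\<^bsub>C\<^esub> i1 = Zero C A B \<and> p1 \<bullet>\<^bsub>C\<^esub> i2 = Zero C B A \<and>
     Add C (i1 \<bullet>\<^bsub>C\<^esub> p1) (i2 \<bullet>\<^bsub>C\<^esub> p2) = Id C P)"

locale additive_category = category +
  assumes hom_comm_group: "A \<in> Obj C \<Longrightarrow> B \<in> Obj C \<Longrightarrow> comm_group (hom_group C A B)"
    and Comp_Add_right: "f \<in> Hom C A B \<Longrightarrow> f' \<in> Hom C A B \<Longrightarrow> g \<in> Hom C B D
          \<Longrightarrow> g \<bullet> Add C f f' = Add C (g \<bullet> f) (g \<bullet> f')"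
    and Comp_Add_left: "f \<in> Hom C A B \<Longrightarrow> g \<in> Hom C B D \<Longrightarrow> g' \<in> Hom C B D
          \<Longrightarrow> Add C g g' \<bullet> f = Add C (g \<bullet> f) (g' \<bullet> f)"
    and zero_object_exists: "\<exists>Z. zero_object C Z"
    and biproduct_exists: "A \<in> Obj C \<Longrightarrow> B \<in> Obj C \<Longrightarrow> \<exists>P. is_biproduct C A B P"

definition is_functor ::
  "('o, 'm, 'z) shift_category_scheme \<Rightarrow> ('p, 'n, 'w) shift_category_scheme
    \<Rightarrow> ('o, 'm, 'p, 'n) ftor \<Rightarrow> bool" where
  "is_functor C D F \<longleftrightarrow>
     (\<forall>A \<in> Obj C. FO F A \<in> Obj D) \<and>
     (\<forall>A B. \<forall>f \<in> Hom C A B. FM F f \<in> Hom D (FO F A) (FO F B)) \<and>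
     (\<forall>A \<in> Obj C. FM F (Id C A) = Id D (FO F A)) \<and>
     (\<forall>A B E. \<forall>f \<in> Hom C A B. \<forall>g \<in> Hom C B E. FM F (g \<bullet>\<^bsub>C\<^esub> f) = FM F g \<bullet>\<^bsub>D\<^esub> FM F f)"

definition additive_functor ::
  "('o, 'm, 'z) shift_category_scheme \<Rightarrow> ('p, 'n, 'w) shift_category_scheme
    \<Rightarrow> ('o, 'm, 'p, 'n) ftor \<Rightarrow> bool" where
  "additive_functor C D F \<longleftrightarrow> is_functor C D F \<and>
     (\<forall>A B. \<forall>f \<in> Hom C A B. \<forall>g \<in> Hom C A B. FM F (Add C f g) = Add D (FM F f) (FM F g))"

definition fully_faithful ::
  "('o, 'm, 'z) shift_category_scheme \<Rightarrow> ('p, 'n, 'w) shift_category_scheme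
    \<Rightarrow> ('o, 'm, 'p, 'n) ftor \<Rightarrow> bool" where
  "fully_faithful C D F \<longleftrightarrow>
     (\<forall>A \<in> Obj C. \<forall>B \<in> Obj C. bij_betw (FM F) (Hom C A B) (Hom D (FO F A) (FO F B)))"

definition essentially_surjective ::
  "('o, 'm, 'z) shift_category_scheme \<Rightarrow> ('p, 'n, 'w) shift_category_scheme
    \<Rightarrow> ('o, 'm, 'p, 'n) ftor \<Rightarrow> bool" where
  "essentially_surjective C D F \<longleftrightarrow> (\<forall>B \<in> Obj D. \<exists>A \<in> Obj C. iso_objects D (FO F A) B)"

text \<open>\<open>F \<stileturn> G\<close> with unit \<open>\<eta>\<close> and counit \<open>\<epsilon>\<close>.\<close>

definition adjunction ::
  "('o, 'm, 'z) shift_category_scheme \<Rightarrow> ('p, 'n, 'w) shift_category_scheme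
    \<Rightarrow> ('o, 'm, 'p, 'n) ftor \<Rightarrow> ('p, 'n, 'o, 'm) ftor \<Rightarrow> ('o \<Rightarrow> 'm) \<Rightarrow> ('p \<Rightarrow> 'n) \<Rightarrow> bool" where
  "adjunction C D F G \<eta> \<epsilon> \<longleftrightarrow>
     is_functor C D F \<and> is_functor D C G \<and>
     (\<forall>A \<in> Obj C. \<eta> A \<in> Hom C A (FO G (FO F A))) \<and>
     (\<forall>A B. \<forall>f \<in> Hom C A B. FM G (FM F f) \<bullet>\<^bsub>C\<^esub> \<eta> A = \<eta> B \<bullet>\<^bsub>C\<^esub> f) \<and>
     (\<forall>X \<in> Obj D. \<epsilon> X \<in> Hom D (FO F (FO G X)) X) \<and>
     (\<forall>X Y. \<forall>f \<in> Hom D X Y. \<epsilon> Y \<bullet>\<^bsub>D\<^esub> FM F (FM G f) = f \<bullet>\<^bsub>D\<^esub> \<epsilon> X) \<and>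
     (\<forall>A \<in> Obj C. \<epsilon> (FO F A) \<bullet>\<^bsub>D\<^esub> FM F (\<eta> A) = Id D (FO F A)) \<and>
     (\<forall>X \<in> Obj D. FM G (\<epsilon> X) \<bullet>\<^bsub>C\<^esub> \<eta> (FO G X) = Id C (FO G X))"


section \<open>Triangulated categories\<close>

text \<open>
  \<open>Dist C A B D f g h\<close>: the diagram with maps \<open>f : A \<rightarrow> B\<close>, \<open>g : B \<rightarrow> D\<close>, \<open>h : D \<rightarrow> A[1]\<close>
  is a distinguished triangle.
\<close>

record ('o, 'm) tri_category = "('o, 'm) shift_category" +
  Dist :: "'o \<Rightarrow> 'o \<Rightarrow> 'o \<Rightarrow> 'm \<Rightarrow> 'm \<Rightarrow> 'm \<Rightarrow> bool"

definition is_triangle ::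
  "('o, 'm, 'z) shift_category_scheme \<Rightarrow> 'o \<Rightarrow> 'o \<Rightarrow> 'o \<Rightarrow> 'm \<Rightarrow> 'm \<Rightarrow> 'm \<Rightarrow> bool" where
  "is_triangle C A B D f g h \<longleftrightarrow> f \<in> Hom C A B \<and> g \<in> Hom C B D \<and> h \<in> Hom C D (ShO C A)"

definition triangles_isomorphic ::
  "('o, 'm, 'z) shift_category_scheme \<Rightarrow> 'o \<Rightarrow> 'o \<Rightarrow> 'o \<Rightarrow> 'm \<Rightarrow> 'm \<Rightarrow> 'm
    \<Rightarrow> 'o \<Rightarrow> 'o \<Rightarrow> 'o \<Rightarrow> 'm \<Rightarrow> 'm \<Rightarrow> 'm \<Rightarrow> bool" where
  "triangles_isomorphic C A B D f g h A' B' D' f' g' h' \<longleftrightarrow>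
     (\<exists>a b d. is_iso C A A' a \<and> is_iso C B B' b \<and> is_iso C D D' d \<and>
        b \<bullet>\<^bsub>C\<^esub> f = f' \<bullet>\<^bsub>C\<^esub> a \<and> d \<bullet>\<^bsub>C\<^esub> g = g' \<bullet>\<^bsub>C\<^esub> b \<and> ShM C a \<bullet>\<^bsub>C\<^esub> h = h' \<bullet>\<^bsub>C\<^esub> d)"

text \<open>
  The shift is only required to be an autoequivalence; this includes the case where it is an
  automorphism.
\<close>

locale triangulated_category =
  additive_category C for C :: "('o, 'm, 'z) tri_category_scheme" (structure) +
  assumes shift_functor: "additive_functor C C (Shift C)"
    and shift_fully_faithful: "fully_faithful C C (Shift C)"
    and shift_ess_surj: "essentially_surjective C C (Shift C)"
    and Dist_triangle: "Dist C A B D f g h \<Longrightarrow> is_triangle C A B D f g h"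
    and TR1_iso: "Dist C A B D f g h \<Longrightarrow> is_triangle C A' B' D' f' g' h'
          \<Longrightarrow> triangles_isomorphic C A B D f g h A' B' D' f' g' h'
          \<Longrightarrow> Dist C A' B' D' f' g' h'"
    and TR1_id: "A \<in> Obj C \<Longrightarrow> zero_object C Z
          \<Longrightarrow> Dist C A A Z (Id C A) (Zero C A Z) (Zero C Z (ShO C A))"
    and TR1_cone: "f \<in> Hom C A B \<Longrightarrow> \<exists>D g h. Dist C A B D f g h"
    and TR2: "is_triangle C A B D f g h
          \<Longrightarrow> Dist C A B D f g h \<longleftrightarrow> Dist C B D (ShO C A) g h (Neg C (ShO C A) (ShO C B) (ShM C f))"
    and TR3: "Dist C A B D f g h \<Longrightarrow> Dist C A' B' D' f' g' h'
          \<Longrightarrow> a \<in> Hom C A A' \<Longrightarrow> b \<in> Hom C B B' \<Longrightarrow> b \<bullet> f = f' \<bullet> a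
          \<Longrightarrow> \<exists>d \<in> Hom C D D'. d \<bullet> g = g' \<bullet> b \<and> ShM C a \<bullet> h = h' \<bullet> d"
    and TR4: "Dist C X Y Z' f f' f'' \<Longrightarrow> Dist C Y Z X' g g' g'' \<Longrightarrow> Dist C X Z Y' (g \<bullet> f) h' h''
          \<Longrightarrow> \<exists>u v. Dist C Z' Y' X' u v (ShM C f' \<bullet> g'') \<and>
                u \<bullet> f' = h' \<bullet> g \<and> h'' \<bullet> u = f'' \<and> v \<bullet> h' = g' \<and> g'' \<bullet> v = ShM C f \<bullet> h''"

definition triangle_functor ::
  "('o, 'm, 'z) tri_category_scheme \<Rightarrow> ('p, 'n, 'w) tri_category_scheme
    \<Rightarrow> ('o, 'm, 'p, 'n) ftor \<Rightarrow> bool" where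
  "triangle_functor C D F \<longleftrightarrow> additive_functor C D F \<and>
     (\<exists>\<theta>. (\<forall>A \<in> Obj C. is_iso D (FO F (ShO C A)) (ShO D (FO F A)) (\<theta> A)) \<and>
        (\<forall>A B. \<forall>f \<in> Hom C A B. \<theta> B \<bullet>\<^bsub>D\<^esub> FM F (ShM C f) = ShM D (FM F f) \<bullet>\<^bsub>D\<^esub> \<theta> A) \<and>
        (\<forall>A B E f g h. Dist C A B E f g h \<longrightarrow>
           Dist D (FO F A) (FO F B) (FO F E) (FM F f) (FM F g) (\<theta> A \<bullet>\<^bsub>D\<^esub> FM F h)))"


section \<open>Full subcategories and cotorsion pairs\<close>

text \<open>A full subcategory is represented by its set of objects.\<close>

definition closed_under_iso :: "('o, 'm, 'z) shift_category_scheme \<Rightarrow> 'o set \<Rightarrow> bool" where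
  "closed_under_iso C X \<longleftrightarrow> (\<forall>A \<in> X. \<forall>B. iso_objects C A B \<longrightarrow> B \<in> X)"

definition full_additive_subcategory :: "('o, 'm, 'z) shift_category_scheme \<Rightarrow> 'o set \<Rightarrow> bool" where
  "full_additive_subcategory C X \<longleftrightarrow> X \<subseteq> Obj C \<and> (\<exists>Z \<in> X. zero_object C Z) \<and>
     (\<forall>A \<in> X. \<forall>B \<in> X. \<exists>P \<in> X. is_biproduct C A B P)"

definition closed_under_summands :: "('o, 'm, 'z) shift_category_scheme \<Rightarrow> 'o set \<Rightarrow> bool" where
  "closed_under_summands C X \<longleftrightarrow> (\<forall>P \<in> X. \<forall>A B. is_biproduct C A B P \<longrightarrow> A \<in> X)"

text \<open>
  \<open>X[1]\<close> and \<open>X[-1]\<close> as isomorphism-closed full subcategories, expressed without choosing a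
  quasi-inverse of the shift.
\<close>

definition shift_up :: "('o, 'm, 'z) shift_category_scheme \<Rightarrow> 'o set \<Rightarrow> 'o set" where
  "shift_up C X = {A \<in> Obj C. \<exists>B \<in> X. iso_objects C A (ShO C B)}"

definition shift_down :: "('o, 'm, 'z) shift_category_scheme \<Rightarrow> 'o set \<Rightarrow> 'o set" where
  "shift_down C X = {A \<in> Obj C. \<exists>B \<in> X. iso_objects C (ShO C A) B}"

definition star :: "('o, 'm, 'z) tri_category_scheme \<Rightarrow> 'o set \<Rightarrow> 'o set \<Rightarrow> 'o set" where
  "star C X Y = {D \<in> Obj C. \<exists>A \<in> X. \<exists>B \<in> Y. \<exists>f g h. Dist C A D B f g h}"

definition Ext1 :: "('o, 'm, 'z) shift_category_scheme \<Rightarrow> 'o \<Rightarrow> 'o \<Rightarrow> 'm set" where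
  "Ext1 C A B = Hom C A (ShO C B)"

definition Ext1_vanishes :: "('o, 'm, 'z) shift_category_scheme \<Rightarrow> 'o set \<Rightarrow> 'o set \<Rightarrow> bool" where
  "Ext1_vanishes C X Y \<longleftrightarrow> (\<forall>A \<in> X. \<forall>B \<in> Y. Ext1 C A B = {Zero C A (ShO C B)})"

definition right_orthogonal :: "('o, 'm, 'z) shift_category_scheme \<Rightarrow> 'o set \<Rightarrow> 'o set" where
  "right_orthogonal C X = {A \<in> Obj C. \<forall>B \<in> X. Hom C B A = {Zero C B A}}"

definition left_orthogonal :: "('o, 'm, 'z) shift_category_scheme \<Rightarrow> 'o set \<Rightarrow> 'o set" where
  "left_orthogonal C X = {A \<in> Obj C. \<forall>B \<in> X. Hom C A B = {Zero C A B}}"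

definition cotorsion_pair :: "('o, 'm, 'z) tri_category_scheme \<Rightarrow> 'o set \<times> 'o set \<Rightarrow> bool" where
  "cotorsion_pair C = (\<lambda>(U, V).
     full_additive_subcategory C U \<and> closed_under_iso C U \<and> closed_under_summands C U \<and>
     full_additive_subcategory C V \<and> closed_under_iso C V \<and> closed_under_summands C V \<and>
     Obj C = star C U (shift_up C V) \<and> Ext1_vanishes C U V)"

definition twin_cotorsion_pair ::
  "('o, 'm, 'z) tri_category_scheme \<Rightarrow> ('o set \<times> 'o set) \<times> ('o set \<times> 'o set) \<Rightarrow> bool" where
  "twin_cotorsion_pair C = (\<lambda>((S, T), (U, V)).
     cotorsion_pair C (S, T) \<and> cotorsion_pair C (U, V) \<and> Ext1_vanishes C S V)"

definition Hovey_TCP ::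
  "('o, 'm, 'z) tri_category_scheme \<Rightarrow> ('o set \<times> 'o set) \<times> ('o set \<times> 'o set) \<Rightarrow> bool" where
  "Hovey_TCP C = (\<lambda>((S, T), (U, V)).
     twin_cotorsion_pair C ((S, T), (U, V)) \<and>
     star C S (shift_up C V) = star C (shift_down C S) V)"


section \<open>Triangulated subcategories and Verdier quotients\<close>

definition triangulated_subcategory :: "('o, 'm, 'z) tri_category_scheme \<Rightarrow> 'o set \<Rightarrow> bool" where
  "triangulated_subcategory C N \<longleftrightarrow> full_additive_subcategory C N \<and> closed_under_iso C N \<and>
     (\<forall>A \<in> Obj C. A \<in> N \<longleftrightarrow> ShO C A \<in> N) \<and>
     (\<forall>A B D f g h. Dist C A B D f g h \<and> A \<in> N \<and> B \<in> N \<longrightarrow> D \<in> N)"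

definition full_subcategory ::
  "('o, 'm, 'z) tri_category_scheme \<Rightarrow> 'o set \<Rightarrow> ('o, 'm) tri_category" where
  "full_subcategory C N = \<lparr>
     Obj = N,
     Hom = (\<lambda>A B. if A \<in> N \<and> B \<in> N then Hom C A B else {}),
     Id = Id C, Comp = Comp C, Add = Add C, Zero = Zero C, Shift = Shift C,
     Dist = (\<lambda>A B D f g h. A \<in> N \<and> B \<in> N \<and> D \<in> N \<and> Dist C A B D f g h)\<rparr>"

text \<open>The arguments of \<open>inclusion\<close> only serve to fix its type.\<close>

definition inclusion :: "('o, 'm, 'z) tri_category_scheme \<Rightarrow> 'o set \<Rightarrow> ('o, 'm, 'o, 'm) ftor" where
  "inclusion C N = \<lparr>FO = (\<lambda>A. A), FM = (\<lambda>f. f)\<rparr>"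

definition cone_in :: "('o, 'm, 'z) tri_category_scheme \<Rightarrow> 'o set \<Rightarrow> 'o \<Rightarrow> 'o \<Rightarrow> 'm \<Rightarrow> bool" where
  "cone_in C N A B s \<longleftrightarrow> (\<exists>D g h. Dist C A B D s g h \<and> D \<in> N)"

text \<open>
  A roof \<open>(Z, s, f)\<close> from \<open>X\<close> to \<open>Y\<close> consists of \<open>s : Z \<rightarrow> X\<close> with cone in \<open>N\<close> and
  \<open>f : Z \<rightarrow> Y\<close>; it represents the fraction \<open>f s\<^sup>-\<^sup>1\<close>.
\<close>

type_synonym ('o, 'm) roof = "'o \<times> 'm \<times> 'm"

definition roofs ::
  "('o, 'm, 'z) tri_category_scheme \<Rightarrow> 'o set \<Rightarrow> 'o \<Rightarrow> 'o \<Rightarrow> ('o, 'm) roof set" where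
  "roofs C N X Y = {(Z, s, f). cone_in C N Z X s \<and> f \<in> Hom C Z Y}"

definition roof_rel ::
  "('o, 'm, 'z) tri_category_scheme \<Rightarrow> 'o set \<Rightarrow> 'o \<Rightarrow> 'o \<Rightarrow> ('o, 'm) roof rel" where
  "roof_rel C N X Y = {((Z, s, f), (Z', s', f')).
     (Z, s, f) \<in> roofs C N X Y \<and> (Z', s', f') \<in> roofs C N X Y \<and>
     (\<exists>W. \<exists>u \<in> Hom C W Z. \<exists>u' \<in> Hom C W Z'.
        s \<bullet>\<^bsub>C\<^esub> u = s' \<bullet>\<^bsub>C\<^esub> u' \<and> cone_in C N W X (s \<bullet>\<^bsub>C\<^esub> u) \<and> f \<bullet>\<^bsub>C\<^esub> u = f' \<bullet>\<^bsub>C\<^esub> u')}"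

text \<open>
  Morphisms of the Verdier quotient are equivalence classes of roofs.  The operations on classes
  are given as the set of all roofs equivalent to a result computed from some representatives:
  composition through a completion of the middle cospan, addition through a common denominator.
\<close>

definition quotient_comp ::
  "('o, 'm, 'z) tri_category_scheme \<Rightarrow> 'o set
    \<Rightarrow> ('o, 'm) roof set \<Rightarrow> ('o, 'm) roof set \<Rightarrow> ('o, 'm) roof set" where
  "quotient_comp C N \<psi> \<phi> = {r. \<exists>X Y Y' Z s f Z' t g W t' f'.
     (Z, s, f) \<in> \<phi> \<inter> roofs C N X Y \<and> (Z', t, g) \<in> \<psi> \<inter> roofs C N Y Y' \<and>
     cone_in C N W Z t' \<and> f' \<in> Hom C W Z' \<and> f \<bullet>\<^bsub>C\<^esub> t' = t \<bullet>\<^bsub>C\<^esub> f' \<and>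
     ((W, s \<bullet>\<^bsub>C\<^esub> t', g \<bullet>\<^bsub>C\<^esub> f'), r) \<in> roof_rel C N X Y'}"

definition quotient_add ::
  "('o, 'm, 'z) tri_category_scheme \<Rightarrow> 'o set
    \<Rightarrow> ('o, 'm) roof set \<Rightarrow> ('o, 'm) roof set \<Rightarrow> ('o, 'm) roof set" where
  "quotient_add C N \<phi> \<psi> = {r. \<exists>X Y Z s f g.
     (Z, s, f) \<in> \<phi> \<inter> roofs C N X Y \<and> (Z, s, g) \<in> \<psi> \<inter> roofs C N X Y \<and>
     ((Z, s, Add C f g), r) \<in> roof_rel C N X Y}"

definition quotient_functor ::
  "('o, 'm, 'z) tri_category_scheme \<Rightarrow> 'o set \<Rightarrow> ('o, 'm, 'o, ('o, 'm) roof set) ftor" where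
  "quotient_functor C N = \<lparr>
     FO = (\<lambda>A. A),
     FM = (\<lambda>f. {r. \<exists>A B. f \<in> Hom C A B \<and> ((A, Id C A, f), r) \<in> roof_rel C N A B})\<rparr>"

definition quotient_shift ::
  "('o, 'm, 'z) tri_category_scheme \<Rightarrow> 'o set
    \<Rightarrow> ('o, ('o, 'm) roof set, 'o, ('o, 'm) roof set) ftor" where
  "quotient_shift C N = \<lparr>
     FO = ShO C,
     FM = (\<lambda>\<phi>. {r. \<exists>X Y Z s f. (Z, s, f) \<in> \<phi> \<inter> roofs C N X Y \<and>
             ((ShO C Z, ShM C s, ShM C f), r) \<in> roof_rel C N (ShO C X) (ShO C Y)})\<rparr>"

definition quotient_category ::
  "('o, 'm, 'z) tri_category_scheme \<Rightarrow> 'o set \<Rightarrow> ('o, ('o, 'm) roof set) shift_category" where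
  "quotient_category C N = \<lparr>
     Obj = Obj C,
     Hom = (\<lambda>X Y. if X \<in> Obj C \<and> Y \<in> Obj C then roofs C N X Y // roof_rel C N X Y else {}),
     Id = (\<lambda>A. FM (quotient_functor C N) (Id C A)),
     Comp = quotient_comp C N,
     Add = quotient_add C N,
     Zero = (\<lambda>A B. FM (quotient_functor C N) (Zero C A B)),
     Shift = quotient_shift C N\<rparr>"

text \<open>
  The distinguished triangles of the quotient are those isomorphic to the image of a distinguished
  triangle of \<open>C\<close>.  As the quotient functor commutes strictly with the shift, no comparison
  morphism enters.
\<close>

definition Verdier_quotient ::
  "('o, 'm, 'z) tri_category_scheme \<Rightarrow> 'o set \<Rightarrow> ('o, ('o, 'm) roof set) tri_category" where
  "Verdier_quotient C N = shift_category.extend (quotient_category C N) \<lparr>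
     Dist = (\<lambda>A B D f g h. is_triangle (quotient_category C N) A B D f g h \<and>
       (\<exists>A' B' D' f' g' h'. Dist C A' B' D' f' g' h' \<and>
          triangles_isomorphic (quotient_category C N) A B D f g h A' B' D'
            (FM (quotient_functor C N) f') (FM (quotient_functor C N) g')
            (FM (quotient_functor C N) h')))\<rparr>"


section \<open>Recollements\<close>

text \<open>
  The functors \<open>iL\<close>, \<open>iR\<close>, \<open>jL\<close>, \<open>jR\<close> are the left and right adjoints of the inclusion \<open>i\<close>
  (usually written \<open>i\<^sup>*\<close> and \<open>i\<^sup>!\<close>) and of the quotient functor \<open>\<ell>\<close> (usually \<open>j\<^sub>!\<close> and \<open>j\<^sub>*\<close>).
\<close>

locale recollement =
  triangulated_category C for C :: "('o, 'm, 'z) tri_category_scheme" (structure) +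
  fixes N :: "'o set"
    and iL iR :: "('o, 'm, 'o, 'm) ftor"
    and jL jR :: "('o, ('o, 'm) roof set, 'o, 'm) ftor"
    and \<eta>_iL \<epsilon>_iL \<eta>_iR \<epsilon>_iR :: "'o \<Rightarrow> 'm"
    and \<eta>_jL :: "'o \<Rightarrow> ('o, 'm) roof set" and \<epsilon>_jL :: "'o \<Rightarrow> 'm"
    and \<eta>_jR :: "'o \<Rightarrow> 'm" and \<epsilon>_jR :: "'o \<Rightarrow> ('o, 'm) roof set"
  assumes subcategory: "triangulated_subcategory C N"
    and triangle_i: "triangle_functor (full_subcategory C N) C (inclusion C N)"
    and triangle_iL: "triangle_functor C (full_subcategory C N) iL"
    and triangle_iR: "triangle_functor C (full_subcategory C N) iR"
    and triangle_l: "triangle_functor C (Verdier_quotient C N) (quotient_functor C N)"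
    and triangle_jL: "triangle_functor (Verdier_quotient C N) C jL"
    and triangle_jR: "triangle_functor (Verdier_quotient C N) C jR"
    and adjunction_iL: "adjunction C (full_subcategory C N) iL (inclusion C N) \<eta>_iL \<epsilon>_iL"
    and adjunction_iR: "adjunction (full_subcategory C N) C (inclusion C N) iR \<eta>_iR \<epsilon>_iR"
    and adjunction_jL: "adjunction (Verdier_quotient C N) C jL (quotient_functor C N) \<eta>_jL \<epsilon>_jL"
    and adjunction_jR: "adjunction C (Verdier_quotient C N) (quotient_functor C N) jR \<eta>_jR \<epsilon>_jR"
    and fully_faithful_i: "fully_faithful (full_subcategory C N) C (inclusion C N)"
    and fully_faithful_jL: "fully_faithful (Verdier_quotient C N) C jL"
    and fully_faithful_jR: "fully_faithful (Verdier_quotient C N) C jR"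
    and quotient_vanishes:
      "A \<in> N \<Longrightarrow> zero_object (Verdier_quotient C N) (FO (quotient_functor C N) (FO (inclusion C N) A))"
    and triangle_iR_jR: "A \<in> Obj C \<Longrightarrow>
      \<exists>h. Dist C (FO (inclusion C N) (FO iR A)) A (FO jR (FO (quotient_functor C N) A))
            (\<epsilon>_iR A) (\<eta>_jR A) h"
    and triangle_jL_iL: "A \<in> Obj C \<Longrightarrow>
      \<exists>h. Dist C (FO jL (FO (quotient_functor C N) A)) A (FO (inclusion C N) (FO iL A))
            (\<epsilon>_jL A) (\<eta>_iL A) h"

end

theory Submission
  imports Defs
begin

text \<open>
  Inside \<open>N\<close> a cotorsion pair is determined by orthogonality: \<open>S\<close> consists of the objects of \<open>N\<close>
  without nonzero maps to \<open>V[1]\<close>, and \<open>V\<close> of those without nonzero maps from \<open>S[-1]\<close>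
  (\<open>S_iff_orthogonal\<close>, \<open>V_iff_orthogonal\<close>).  As \<open>V[1]\<close> and \<open>S[-1]\<close> lie in \<open>N\<close>, the adjunctions
  \<open>\<C>(i\<^sup>*A, X) \<cong> \<C>(A, X)\<close> and \<open>\<C>(X, i\<^sup>!A) \<cong> \<C>(X, A)\<close> for \<open>X \<in> N\<close> carry these descriptions over to
  \<open>U = \<^sup>\<bottom>V[1]\<close> and \<open>T = S[-1]\<^sup>\<bottom>\<close> in \<open>C\<close> (\<open>preimage_S_eq\<close>, \<open>preimage_V_eq\<close>).  All closure properties of
  \<open>U\<close> and \<open>T\<close> and the vanishing of \<open>Ext\<^sup>1(S, T)\<close> and \<open>Ext\<^sup>1(U, V)\<close> follow from this.

  What remains are the decompositions of an object \<open>A\<close> of \<open>C\<close>.  For \<open>C = S * T[1]\<close>, decompose \<open>i\<^sup>!A\<close> in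
  \<open>N\<close> as \<open>X \<rightarrow> i\<^sup>!A \<rightarrow> W\<close> with \<open>X \<in> S\<close> and \<open>W \<in> V[1]\<close>.  By the octahedral axiom the cone \<open>Y\<close> of the
  composite \<open>X \<rightarrow> i\<^sup>!A \<rightarrow> A\<close> sits in a triangle \<open>W \<rightarrow> Y \<rightarrow> j\<^sub>*\<ell>A\<close>; objects of \<open>S\<close> have no nonzero maps to \<open>W\<close>,
  and none to \<open>j\<^sub>*\<ell>A\<close> because \<open>\<ell>\<close> kills \<open>N\<close>.  Hence \<open>Y \<in> T[1]\<close> (\<open>decomposition_S_T\<close>).  Dually, the cocone of
  \<open>A \<rightarrow> i\<^sup>*A \<rightarrow> W\<close> is an extension of an object of \<open>S\<close> by \<open>j\<^sub>!\<ell>A\<close> and so lies in \<open>U\<close> (\<open>decomposition_U_V\<close>).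

  The Hovey condition holds because both sides are equal to \<open>N\<close>: they are contained in \<open>N\<close>, which is
  closed under extensions, and for \<open>A \<in> N\<close> the cotorsion pair decomposes \<open>A\<close> for the one side and \<open>A[1]\<close>
  for the other (\<open>star_S_V1_eq_N\<close>, \<open>star_S1_V_eq_N\<close>).
\<close>

section \<open>Additive categories\<close>

context category
begin

lemma is_iso_Hom: "is_iso C A B f \<Longrightarrow> f \<in> Hom C A B"
  by (simp add: is_iso_def)

lemma is_iso_Id: "A \<in> Obj C \<Longrightarrow> is_iso C A A (Id C A)"
  unfolding is_iso_def using Id_Hom Id_left by blast

lemma is_iso_inverse:
  assumes "is_iso C A B f"
  obtains g where "is_iso C B A g" "g \<bullet> f = Id C A" "f \<bullet> g = Id C B"
  using assms unfolding is_iso_def by blast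

lemma iso_objects_sym: "iso_objects C A B \<Longrightarrow> iso_objects C B A"
  unfolding iso_objects_def by (meson is_iso_inverse)

lemma iso_objects_refl: "A \<in> Obj C \<Longrightarrow> iso_objects C A A"
  unfolding iso_objects_def using is_iso_Id by blast

lemma iso_objects_Obj: "iso_objects C A B \<Longrightarrow> A \<in> Obj C \<and> B \<in> Obj C"
  unfolding iso_objects_def is_iso_def using Hom_Obj by blast

lemma is_biproduct_Obj: "is_biproduct C A B P \<Longrightarrow> A \<in> Obj C \<and> B \<in> Obj C \<and> P \<in> Obj C"
  unfolding is_biproduct_def using Hom_Obj by blast

end

context additive_category
begin

lemma Zero_Hom: "A \<in> Obj C \<Longrightarrow> B \<in> Obj C \<Longrightarrow> Zero C A B \<in> Hom C A B"
  using comm_group.axioms(2)[OF hom_comm_group, THEN group.is_monoid, THEN monoid.one_closed]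
  by (simp add: hom_group_def)

lemma Add_Hom: "f \<in> Hom C A B \<Longrightarrow> g \<in> Hom C A B \<Longrightarrow> Add C f g \<in> Hom C A B"
  using comm_group.axioms(2)[OF hom_comm_group, THEN group.is_monoid, THEN monoid.m_closed, of A B f g]
    Hom_Obj[of f A B]
  by (simp add: hom_group_def)

lemma Neg_Hom: "f \<in> Hom C A B \<Longrightarrow> Neg C A B f \<in> Hom C A B"
  using comm_group.axioms(2)[OF hom_comm_group, THEN group.inv_closed, of A B f] Hom_Obj[of f A B]
  by (simp add: hom_group_def)

lemma Neg_Neg: "f \<in> Hom C A B \<Longrightarrow> Neg C A B (Neg C A B f) = f"
  using comm_group.axioms(2)[OF hom_comm_group, THEN group.inv_inv, of A B f] Hom_Obj[of f A B]
  by (simp add: hom_group_def)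

lemma Add_Neg: "f \<in> Hom C A B \<Longrightarrow> Add C f (Neg C A B f) = Zero C A B"
  using comm_group.axioms(2)[OF hom_comm_group, THEN group.r_inv, of A B f] Hom_Obj[of f A B]
  by (simp add: hom_group_def)

lemma Add_Zero: "f \<in> Hom C A B \<Longrightarrow> Add C f (Zero C A B) = f"
  using comm_group.axioms(2)[OF hom_comm_group, THEN group.is_monoid, THEN monoid.r_one, of A B f]
    Hom_Obj[of f A B]
  by (simp add: hom_group_def)

lemma Add_commute: "f \<in> Hom C A B \<Longrightarrow> g \<in> Hom C A B \<Longrightarrow> Add C f g = Add C g f"
  using comm_monoid.m_comm[OF comm_group.axioms(1)[OF hom_comm_group], of A B f g] Hom_Obj[of f A B]
  by (simp add: hom_group_def)

lemma Add_assoc: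
  "f \<in> Hom C A B \<Longrightarrow> g \<in> Hom C A B \<Longrightarrow> h \<in> Hom C A B \<Longrightarrow>
    Add C (Add C f g) h = Add C f (Add C g h)"
  using comm_group.axioms(2)[OF hom_comm_group, THEN group.is_monoid, THEN monoid.m_assoc,
      of A B f g h] Hom_Obj[of f A B]
  by (simp add: hom_group_def)

lemma eq_Neg_if_Add_eq_Zero:
  assumes "f \<in> Hom C A B" "g \<in> Hom C A B" "Add C f g = Zero C A B"
  shows "f = Neg C A B g"
proof -
  have *: "Neg C A B g \<in> Hom C A B" using Neg_Hom assms by blast
  have "Zero C A B \<in> Hom C A B" using Zero_Hom Hom_Obj assms(1) by blast
  have "f = Add C f (Add C g (Neg C A B g))" by (simp add: Add_Neg Add_Zero assms)
  also have "\<dots> = Add C (Zero C A B) (Neg C A B g)"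
    using Add_assoc[OF assms(1,2) *] assms(3) by simp
  also have "\<dots> = Neg C A B g"
    using Add_commute[OF \<open>Zero C A B \<in> _\<close> *] Add_Zero[OF *] by simp
  finally show ?thesis .
qed

lemma eq_if_diff_Zero:
  assumes "f \<in> Hom C A B" "g \<in> Hom C A B" "Add C f (Neg C A B g) = Zero C A B"
  shows "f = g"
  using eq_Neg_if_Add_eq_Zero[OF assms(1) Neg_Hom assms(3)] assms(2) Neg_Neg by metis

lemma Zero_if_idempotent:
  assumes "f \<in> Hom C A B" "Add C f f = f"
  shows "f = Zero C A B"
  using Add_Neg[OF assms(1)] Add_assoc[OF assms(1) assms(1) Neg_Hom[OF assms(1)]]
    Add_Zero[OF assms(1)] assms(2) by simp

lemma Comp_Zero:
  assumes "g \<in> Hom C B D" "A \<in> Obj C"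
  shows "g \<bullet> Zero C A B = Zero C A D"
proof -
  have z: "Zero C A B \<in> Hom C A B" using Zero_Hom assms Hom_Obj by blast
  show ?thesis
    using Zero_if_idempotent[OF Comp_Hom[OF z assms(1)]] Comp_Add_right[OF z z assms(1)]
      Add_Zero[OF z] by simp
qed

lemma Zero_Comp:
  assumes "f \<in> Hom C A B" "D \<in> Obj C"
  shows "Zero C B D \<bullet> f = Zero C A D"
proof -
  have z: "Zero C B D \<in> Hom C B D" using Zero_Hom assms Hom_Obj by blast
  show ?thesis
    using Zero_if_idempotent[OF Comp_Hom[OF assms(1) z]] Comp_Add_left[OF assms(1) z z]
      Add_Zero[OF z] by simp
qed

lemma Comp_Neg:
  assumes "f \<in> Hom C A B" "g \<in> Hom C B D"
  shows "g \<bullet> Neg C A B f = Neg C A D (g \<bullet> f)"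
proof (rule eq_Neg_if_Add_eq_Zero)
  show "g \<bullet> Neg C A B f \<in> Hom C A D" "g \<bullet> f \<in> Hom C A D"
    using assms Comp_Hom Neg_Hom by blast+
  have "Add C (g \<bullet> Neg C A B f) (g \<bullet> f) = g \<bullet> Add C f (Neg C A B f)"
    using Comp_Add_right[OF Neg_Hom[OF assms(1)] assms]
      Add_commute[OF assms(1) Neg_Hom[OF assms(1)]] by simp
  also have "\<dots> = Zero C A D"
    using Add_Neg[OF assms(1)] Comp_Zero[OF assms(2)] Hom_Obj[OF assms(1)] by simp
  finally show "Add C (g \<bullet> Neg C A B f) (g \<bullet> f) = Zero C A D" .
qed

lemma Neg_Comp:
  assumes "f \<in> Hom C A B" "g \<in> Hom C B D"
  shows "Neg C B D g \<bullet> f = Neg C A D (g \<bullet> f)"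
proof (rule eq_Neg_if_Add_eq_Zero)
  show "Neg C B D g \<bullet> f \<in> Hom C A D" "g \<bullet> f \<in> Hom C A D"
    using assms Comp_Hom Neg_Hom by blast+
  have "Add C (Neg C B D g \<bullet> f) (g \<bullet> f) = Add C g (Neg C B D g) \<bullet> f"
    using Comp_Add_left[OF assms(1) Neg_Hom[OF assms(2)] assms(2)]
      Add_commute[OF assms(2) Neg_Hom[OF assms(2)]] by simp
  also have "\<dots> = Zero C A D"
    using Add_Neg[OF assms(2)] Zero_Comp[OF assms(1)] Hom_Obj[OF assms(2)] by simp
  finally show "Add C (Neg C B D g \<bullet> f) (g \<bullet> f) = Zero C A D" .
qed

lemma Neg_Zero:
  assumes "A \<in> Obj C" "B \<in> Obj C" shows "Neg C A B (Zero C A B) = Zero C A B"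
  using eq_Neg_if_Add_eq_Zero[of "Zero C A B" A B "Zero C A B"] Zero_Hom[OF assms] Add_Zero by simp

text \<open>
  Every map into or out of \<open>Z\<close> factors through the identity of \<open>Z\<close>.
\<close>

lemma zero_object_iff:
  "zero_object C Z \<longleftrightarrow> Z \<in> Obj C \<and> Id C Z = Zero C Z Z"
proof
  assume "zero_object C Z"
  then show "Z \<in> Obj C \<and> Id C Z = Zero C Z Z"
    unfolding zero_object_def using Id_Hom Zero_Hom by blast
next
  assume Z: "Z \<in> Obj C \<and> Id C Z = Zero C Z Z"
  have "f = Zero C A Z" if "f \<in> Hom C A Z" for A f
    using Id_left[OF that] Zero_Comp[OF that] Z by simp
  moreover have "f = Zero C Z A" if "f \<in> Hom C Z A" for A f
    using Id_right[OF that] Comp_Zero[OF that] Z by simp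
  ultimately show "zero_object C Z"
    unfolding zero_object_def using Z Zero_Hom by blast
qed

lemma Hom_zero_iff:
  assumes "A \<in> Obj C" "B \<in> Obj C"
  shows "Hom C A B = {Zero C A B} \<longleftrightarrow> (\<forall>f \<in> Hom C A B. f = Zero C A B)"
  using Zero_Hom[OF assms] by auto

text \<open>
  A map into a retract is recovered from its composite with the section.  This one computation gives
  closure of orthogonals under isomorphisms and under direct summands.
\<close>

lemma retract_Hom_zero_right:
  assumes "i \<in> Hom C A P" "p \<in> Hom C P A" "p \<bullet> i = Id C A" "B \<in> Obj C"
    and "Hom C B P = {Zero C B P}"
  shows "Hom C B A = {Zero C B A}"
proof -
  have "f = Zero C B A" if f: "f \<in> Hom C B A" for f
  proof -
    have "f = p \<bullet> (i \<bullet> f)"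
      using Id_left[OF f] Comp_assoc[OF f assms(1,2)] assms(3) by simp
    moreover have "i \<bullet> f = Zero C B P" using Comp_Hom[OF f assms(1)] assms(5) by blast
    ultimately show ?thesis using Comp_Zero[OF assms(2,4)] by simp
  qed
  then show ?thesis using Hom_zero_iff assms Hom_Obj by metis
qed

lemma retract_Hom_zero_left:
  assumes "i \<in> Hom C A P" "p \<in> Hom C P A" "p \<bullet> i = Id C A" "B \<in> Obj C"
    and "Hom C P B = {Zero C P B}"
  shows "Hom C A B = {Zero C A B}"
proof -
  have "f = Zero C A B" if f: "f \<in> Hom C A B" for f
  proof -
    have "f = (f \<bullet> p) \<bullet> i"
      using Id_right[OF f] Comp_assoc[OF assms(1,2) f] assms(3) by simp
    moreover have "f \<bullet> p = Zero C P B" using Comp_Hom[OF assms(2) f] assms(5) by blast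
    ultimately show ?thesis using Zero_Comp[OF assms(1,4)] by simp
  qed
  then show ?thesis using Hom_zero_iff assms Hom_Obj by metis
qed

lemma iso_Hom_zero_right:
  assumes "iso_objects C P A" "B \<in> Obj C" "Hom C B P = {Zero C B P}"
  shows "Hom C B A = {Zero C B A}"
proof -
  obtain \<phi> where "is_iso C P A \<phi>" using assms(1) unfolding iso_objects_def by blast
  then obtain \<psi> where "\<psi> \<in> Hom C A P" "\<phi> \<in> Hom C P A" "\<phi> \<bullet> \<psi> = Id C A"
    unfolding is_iso_def by blast
  then show ?thesis using retract_Hom_zero_right assms by blast
qed

lemma iso_Hom_zero_left:
  assumes "iso_objects C P A" "B \<in> Obj C" "Hom C P B = {Zero C P B}"
  shows "Hom C A B = {Zero C A B}"
proof -
  obtain \<phi> where "is_iso C P A \<phi>" using assms(1) unfolding iso_objects_def by blast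
  then obtain \<psi> where "\<psi> \<in> Hom C A P" "\<phi> \<in> Hom C P A" "\<phi> \<bullet> \<psi> = Id C A"
    unfolding is_iso_def by blast
  then show ?thesis using retract_Hom_zero_left assms by blast
qed

lemma biproduct_Hom_zero_right:
  assumes "is_biproduct C A A' P" "B \<in> Obj C"
    and "Hom C B A = {Zero C B A}" "Hom C B A' = {Zero C B A'}"
  shows "Hom C B P = {Zero C B P}"
proof -
  obtain i1 i2 p1 p2 where h: "i1 \<in> Hom C A P" "i2 \<in> Hom C A' P" "p1 \<in> Hom C P A" "p2 \<in> Hom C P A'"
    and id: "Add C (i1 \<bullet> p1) (i2 \<bullet> p2) = Id C P"
    using assms(1) unfolding is_biproduct_def by blast
  have P: "P \<in> Obj C" using h(1) Hom_Obj by blast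
  have "f = Zero C B P" if f: "f \<in> Hom C B P" for f
  proof -
    have "f = Add C (i1 \<bullet> p1) (i2 \<bullet> p2) \<bullet> f" using id Id_left[OF f] by simp
    also have "\<dots> = Add C (i1 \<bullet> p1 \<bullet> f) (i2 \<bullet> p2 \<bullet> f)"
      by (rule Comp_Add_left[OF f Comp_Hom[OF h(3,1)] Comp_Hom[OF h(4,2)]])
    also have "\<dots> = Add C (i1 \<bullet> (p1 \<bullet> f)) (i2 \<bullet> (p2 \<bullet> f))"
      using Comp_assoc[OF f h(3,1)] Comp_assoc[OF f h(4,2)] by simp
    also have "\<dots> = Add C (Zero C B P) (Zero C B P)"
      using Comp_Hom[OF f h(3)] Comp_Hom[OF f h(4)] assms(3,4)
        Comp_Zero[OF h(1) assms(2)] Comp_Zero[OF h(2) assms(2)] by simp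
    also have "\<dots> = Zero C B P" using Add_Zero[OF Zero_Hom[OF assms(2) P]] .
    finally show ?thesis .
  qed
  then show ?thesis using Hom_zero_iff[OF assms(2) P] by blast
qed

lemma biproduct_Hom_zero_left:
  assumes "is_biproduct C A A' P" "B \<in> Obj C"
    and "Hom C A B = {Zero C A B}" "Hom C A' B = {Zero C A' B}"
  shows "Hom C P B = {Zero C P B}"
proof -
  obtain i1 i2 p1 p2 where h: "i1 \<in> Hom C A P" "i2 \<in> Hom C A' P" "p1 \<in> Hom C P A" "p2 \<in> Hom C P A'"
    and id: "Add C (i1 \<bullet> p1) (i2 \<bullet> p2) = Id C P"
    using assms(1) unfolding is_biproduct_def by blast
  have P: "P \<in> Obj C" using h(1) Hom_Obj by blast
  have "f = Zero C P B" if f: "f \<in> Hom C P B" for f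
  proof -
    have "f = f \<bullet> Add C (i1 \<bullet> p1) (i2 \<bullet> p2)" using id Id_right[OF f] by simp
    also have "\<dots> = Add C (f \<bullet> (i1 \<bullet> p1)) (f \<bullet> (i2 \<bullet> p2))"
      by (rule Comp_Add_right[OF Comp_Hom[OF h(3,1)] Comp_Hom[OF h(4,2)] f])
    also have "\<dots> = Add C (f \<bullet> i1 \<bullet> p1) (f \<bullet> i2 \<bullet> p2)"
      using Comp_assoc[OF h(3,1) f] Comp_assoc[OF h(4,2) f] by simp
    also have "\<dots> = Add C (Zero C P B) (Zero C P B)"
      using Comp_Hom[OF h(1) f] Comp_Hom[OF h(2) f] assms(3,4)
        Zero_Comp[OF h(3) assms(2)] Zero_Comp[OF h(4) assms(2)] by simp
    also have "\<dots> = Zero C P B" using Add_Zero[OF Zero_Hom[OF P assms(2)]] .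
    finally show ?thesis .
  qed
  then show ?thesis using Hom_zero_iff[OF P assms(2)] by blast
qed

lemma right_orthogonal_additive:
  assumes "X \<subseteq> Obj C"
  shows "full_additive_subcategory C (right_orthogonal C X)"
    and "closed_under_iso C (right_orthogonal C X)"
    and "closed_under_summands C (right_orthogonal C X)"
proof -
  obtain Z where Z: "zero_object C Z" using zero_object_exists by blast
  have "Hom C B Z = {Zero C B Z}" if "B \<in> X" for B
    using Z that assms Zero_Hom unfolding zero_object_def by blast
  then have "Z \<in> right_orthogonal C X"
    using Z unfolding right_orthogonal_def zero_object_def by blast
  moreover have "\<exists>P \<in> right_orthogonal C X. is_biproduct C A A' P"
    if A: "A \<in> right_orthogonal C X" "A' \<in> right_orthogonal C X" for A A'
  proof -
    obtain P where P: "is_biproduct C A A' P"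
      using A biproduct_exists unfolding right_orthogonal_def by blast
    then have "Hom C B P = {Zero C B P}" if "B \<in> X" for B
      using biproduct_Hom_zero_right[OF P] that A assms unfolding right_orthogonal_def by blast
    then show ?thesis using P is_biproduct_Obj unfolding right_orthogonal_def by blast
  qed
  ultimately show "full_additive_subcategory C (right_orthogonal C X)"
    using Z unfolding full_additive_subcategory_def by (auto simp: right_orthogonal_def)
  show "closed_under_iso C (right_orthogonal C X)"
    unfolding closed_under_iso_def
  proof (intro ballI allI impI)
    fix A B assume A: "A \<in> right_orthogonal C X" and i: "iso_objects C A B"
    then have "Hom C E B = {Zero C E B}" if "E \<in> X" for E
      using iso_Hom_zero_right[OF i] that assms unfolding right_orthogonal_def by blast
    then show "B \<in> right_orthogonal C X"
      using iso_objects_Obj[OF i] unfolding right_orthogonal_def by blast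
  qed
  show "closed_under_summands C (right_orthogonal C X)"
    unfolding closed_under_summands_def
  proof (intro ballI allI impI)
    fix P A B assume P: "P \<in> right_orthogonal C X" and b: "is_biproduct C A B P"
    then obtain i p where "i \<in> Hom C A P" "p \<in> Hom C P A" "p \<bullet> i = Id C A"
      unfolding is_biproduct_def by blast
    then have "Hom C E A = {Zero C E A}" if "E \<in> X" for E
      using retract_Hom_zero_right that assms P unfolding right_orthogonal_def by blast
    then show "A \<in> right_orthogonal C X"
      using is_biproduct_Obj[OF b] unfolding right_orthogonal_def by blast
  qed
qed

lemma left_orthogonal_additive:
  assumes "X \<subseteq> Obj C"
  shows "full_additive_subcategory C (left_orthogonal C X)"
    and "closed_under_iso C (left_orthogonal C X)"
    and "closed_under_summands C (left_orthogonal C X)"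
proof -
  obtain Z where Z: "zero_object C Z" using zero_object_exists by blast
  have "Hom C Z B = {Zero C Z B}" if "B \<in> X" for B
    using Z that assms Zero_Hom unfolding zero_object_def by blast
  then have "Z \<in> left_orthogonal C X"
    using Z unfolding left_orthogonal_def zero_object_def by blast
  moreover have "\<exists>P \<in> left_orthogonal C X. is_biproduct C A A' P"
    if A: "A \<in> left_orthogonal C X" "A' \<in> left_orthogonal C X" for A A'
  proof -
    obtain P where P: "is_biproduct C A A' P"
      using A biproduct_exists unfolding left_orthogonal_def by blast
    then have "Hom C P B = {Zero C P B}" if "B \<in> X" for B
      using biproduct_Hom_zero_left[OF P] that A assms unfolding left_orthogonal_def by blast
    then show ?thesis using P is_biproduct_Obj unfolding left_orthogonal_def by blast
  qed
  ultimately show "full_additive_subcategory C (left_orthogonal C X)"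
    using Z unfolding full_additive_subcategory_def by (auto simp: left_orthogonal_def)
  show "closed_under_iso C (left_orthogonal C X)"
    unfolding closed_under_iso_def
  proof (intro ballI allI impI)
    fix A B assume A: "A \<in> left_orthogonal C X" and i: "iso_objects C A B"
    then have "Hom C B E = {Zero C B E}" if "E \<in> X" for E
      using iso_Hom_zero_left[OF i] that assms unfolding left_orthogonal_def by blast
    then show "B \<in> left_orthogonal C X"
      using iso_objects_Obj[OF i] unfolding left_orthogonal_def by blast
  qed
  show "closed_under_summands C (left_orthogonal C X)"
    unfolding closed_under_summands_def
  proof (intro ballI allI impI)
    fix P A B assume P: "P \<in> left_orthogonal C X" and b: "is_biproduct C A B P"
    then obtain i p where "i \<in> Hom C A P" "p \<in> Hom C P A" "p \<bullet> i = Id C A"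
      unfolding is_biproduct_def by blast
    then have "Hom C A E = {Zero C A E}" if "E \<in> X" for E
      using retract_Hom_zero_left that assms P unfolding left_orthogonal_def by blast
    then show "A \<in> left_orthogonal C X"
      using is_biproduct_Obj[OF b] unfolding left_orthogonal_def by blast
  qed
qed

end

section \<open>Triangulated categories\<close>

context triangulated_category
begin

lemma ShO_Obj: "A \<in> Obj C \<Longrightarrow> ShO C A \<in> Obj C"
  using shift_functor unfolding additive_functor_def is_functor_def by blast

lemma ShM_Hom: "f \<in> Hom C A B \<Longrightarrow> ShM C f \<in> Hom C (ShO C A) (ShO C B)"
  using shift_functor unfolding additive_functor_def is_functor_def by blast

lemma ShM_Id: "A \<in> Obj C \<Longrightarrow> ShM C (Id C A) = Id C (ShO C A)"
  using shift_functor unfolding additive_functor_def is_functor_def by blast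

lemma ShM_Comp: "f \<in> Hom C A B \<Longrightarrow> g \<in> Hom C B D \<Longrightarrow> ShM C (g \<bullet> f) = ShM C g \<bullet> ShM C f"
  using shift_functor unfolding additive_functor_def is_functor_def by blast

lemma ShM_Add: "f \<in> Hom C A B \<Longrightarrow> g \<in> Hom C A B \<Longrightarrow> ShM C (Add C f g) = Add C (ShM C f) (ShM C g)"
  using shift_functor unfolding additive_functor_def by blast

lemma ShM_Zero:
  assumes "A \<in> Obj C" "B \<in> Obj C" shows "ShM C (Zero C A B) = Zero C (ShO C A) (ShO C B)"
proof -
  have z: "Zero C A B \<in> Hom C A B" by (rule Zero_Hom[OF assms])
  show ?thesis
    using Zero_if_idempotent[OF ShM_Hom[OF z]] ShM_Add[OF z z] Add_Zero[OF z] by simp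
qed

lemma ShM_inj:
  assumes "f \<in> Hom C A B" "g \<in> Hom C A B" "ShM C f = ShM C g" shows "f = g"
  using shift_fully_faithful assms Hom_Obj[OF assms(1)]
  unfolding fully_faithful_def bij_betw_def inj_on_def by blast

lemma ShM_full:
  assumes "f \<in> Hom C (ShO C A) (ShO C B)" "A \<in> Obj C" "B \<in> Obj C"
  obtains g where "g \<in> Hom C A B" "ShM C g = f"
proof -
  have "ShM C ` Hom C A B = Hom C (ShO C A) (ShO C B)"
    using shift_fully_faithful assms unfolding fully_faithful_def bij_betw_def by blast
  then have "f \<in> ShM C ` Hom C A B" using assms(1) by simp
  then obtain g where "g \<in> Hom C A B" "f = ShM C g" by blast
  then show ?thesis using that by simp
qed

lemma ShO_ess_surj:
  assumes "B \<in> Obj C" obtains A \<phi> where "A \<in> Obj C" "is_iso C (ShO C A) B \<phi>"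
  using shift_ess_surj assms unfolding essentially_surjective_def iso_objects_def by blast

text \<open>
  The shift is fully faithful, so vanishing may be tested after shifting.  This replaces
  every use of a quasi-inverse \<open>[-1]\<close>.
\<close>

lemma Hom_zero_ShO:
  assumes "A \<in> Obj C" "B \<in> Obj C"
  shows "Hom C (ShO C A) (ShO C B) = {Zero C (ShO C A) (ShO C B)} \<longleftrightarrow> Hom C A B = {Zero C A B}"
proof
  assume l: "Hom C (ShO C A) (ShO C B) = {Zero C (ShO C A) (ShO C B)}"
  have "f = Zero C A B" if "f \<in> Hom C A B" for f
    using ShM_inj[OF that Zero_Hom[OF assms]] ShM_Hom[OF that] l ShM_Zero[OF assms] by simp
  then show "Hom C A B = {Zero C A B}" using Hom_zero_iff[OF assms] by blast
next
  assume r: "Hom C A B = {Zero C A B}"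
  have "f = Zero C (ShO C A) (ShO C B)" if f: "f \<in> Hom C (ShO C A) (ShO C B)" for f
  proof -
    obtain g where "g \<in> Hom C A B" "ShM C g = f" using ShM_full[OF f assms] .
    then show ?thesis using r ShM_Zero[OF assms] by simp
  qed
  then show "Hom C (ShO C A) (ShO C B) = {Zero C (ShO C A) (ShO C B)}"
    using Hom_zero_iff ShO_Obj assms by metis
qed

lemma Dist_Hom:
  assumes "Dist C A B D f g h"
  shows "f \<in> Hom C A B" "g \<in> Hom C B D" "h \<in> Hom C D (ShO C A)"
  using Dist_triangle[OF assms] unfolding is_triangle_def by auto

lemma Dist_Obj:
  assumes "Dist C A B D f g h" shows "A \<in> Obj C" "B \<in> Obj C" "D \<in> Obj C"
  using Dist_Hom[OF assms] Hom_Obj by blast+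

lemma Dist_rotate:
  assumes "Dist C A B D f g h"
  shows "Dist C B D (ShO C A) g h (Neg C (ShO C A) (ShO C B) (ShM C f))"
  using TR2[OF Dist_triangle[OF assms]] assms by blast

text \<open>
  Map the trivial triangle \<open>A \<rightarrow> A \<rightarrow> 0\<close> to the given one by \<open>id\<close> and \<open>f\<close>: the third component starts at \<open>0\<close>.
\<close>

lemma Dist_comp_zero:
  assumes "Dist C A B D f g h" shows "g \<bullet> f = Zero C A D"
proof -
  obtain Z where Z: "zero_object C Z" using zero_object_exists by blast
  note A = Dist_Obj(1)[OF assms]
  have "f \<bullet> Id C A = f \<bullet> Id C A" ..
  then obtain d where "d \<in> Hom C Z D" "d \<bullet> Zero C A Z = g \<bullet> f"
    using TR3[OF TR1_id[OF A Z] assms Id_Hom[OF A] Dist_Hom(1)[OF assms]] by blast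
  then show ?thesis using Comp_Zero A by metis
qed

text \<open>
  Exactness of \<open>\<C>(X, -)\<close> at \<open>B\<close>.  The triangle \<open>X \<rightarrow> 0 \<rightarrow> X[1]\<close> maps to the rotated triangle
  \<open>B \<rightarrow> D \<rightarrow> A[1]\<close> by \<open>u\<close> and \<open>0\<close>; the third component \<open>X[1] \<rightarrow> A[1]\<close> is the shift of a lift, because both
  rotations introduce the same sign.
\<close>

lemma Dist_lift:
  assumes t: "Dist C A B D f g h" and u: "u \<in> Hom C X B" and z: "g \<bullet> u = Zero C X D"
  obtains v where "v \<in> Hom C X A" "f \<bullet> v = u"
proof -
  obtain Z where Z: "zero_object C Z" using zero_object_exists by blast
  then have ZO: "Z \<in> Obj C" by (simp add: zero_object_def)
  have X: "X \<in> Obj C" using u Hom_Obj by blast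
  note f = Dist_Hom(1)[OF t] and A = Dist_Obj(1)[OF t]
  have "Zero C Z D \<in> Hom C Z D" using Zero_Hom ZO Dist_Obj[OF t] by blast
  moreover have "Zero C Z D \<bullet> Zero C X Z = g \<bullet> u"
    using z Comp_Zero[OF calculation X] by simp
  ultimately obtain d where d: "d \<in> Hom C (ShO C X) (ShO C A)"
    and eq: "ShM C u \<bullet> Neg C (ShO C X) (ShO C X) (ShM C (Id C X))
      = Neg C (ShO C A) (ShO C B) (ShM C f) \<bullet> d"
    using TR3[OF Dist_rotate[OF TR1_id[OF X Z]] Dist_rotate[OF t] u] by blast
  obtain v where v: "v \<in> Hom C X A" "ShM C v = d" using ShM_full[OF d X A] .
  note su = ShM_Hom[OF u] and sX = Id_Hom[OF ShO_Obj[OF X]] and sf = ShM_Hom[OF f]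
  have "Neg C (ShO C X) (ShO C B) (ShM C u)
      = Neg C (ShO C X) (ShO C B) (ShM C f \<bullet> d)"
    using eq unfolding ShM_Id[OF X] Comp_Neg[OF sX su] Id_right[OF su] Neg_Comp[OF d sf] .
  then have "ShM C u = ShM C f \<bullet> d"
    using Neg_Neg[OF su] Neg_Neg[OF Comp_Hom[OF d sf]] by metis
  then have "ShM C u = ShM C (f \<bullet> v)" using ShM_Comp[OF v(1) f] v(2) by simp
  then have "f \<bullet> v = u" using ShM_inj[OF u Comp_Hom[OF v(1) f]] by simp
  then show ?thesis using that v by blast
qed

text \<open>
  This triangle is the inverse rotation of \<open>X \<rightarrow> X \<rightarrow> 0[1]\<close>, whose last term is again a zero object.
\<close>

lemma Dist_zero_Id:
  assumes Z: "zero_object C Z" and X: "X \<in> Obj C"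
  shows "Dist C Z X X (Zero C Z X) (Id C X) (Zero C X (ShO C Z))"
proof -
  have ZO: "Z \<in> Obj C" using Z by (simp add: zero_object_def)
  have sZ: "zero_object C (ShO C Z)"
    using Z ShM_Id[OF ZO] ShM_Zero[OF ZO ZO] ShO_Obj[OF ZO] by (simp add: zero_object_iff)
  have tri: "is_triangle C Z X X (Zero C Z X) (Id C X) (Zero C X (ShO C Z))"
    unfolding is_triangle_def using Zero_Hom ZO X ShO_Obj Id_Hom by blast
  show ?thesis
    using TR1_id[OF X sZ] TR2[OF tri] ShM_Zero[OF ZO X] Neg_Zero ShO_Obj ZO X by simp
qed

text \<open>
  Exactness of \<open>\<C>(-, X)\<close> at \<open>B\<close>, from mapping the given triangle to \<open>0 \<rightarrow> X \<rightarrow> X\<close>.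
\<close>

lemma Dist_extend:
  assumes t: "Dist C A B D f g h" and u: "u \<in> Hom C B X" and z: "u \<bullet> f = Zero C A X"
  obtains v where "v \<in> Hom C D X" "v \<bullet> g = u"
proof -
  obtain Z where Z: "zero_object C Z" using zero_object_exists by blast
  then have ZO: "Z \<in> Obj C" by (simp add: zero_object_def)
  have X: "X \<in> Obj C" using u Hom_Obj by blast
  note A = Dist_Obj(1)[OF t]
  have zX: "Zero C Z X \<in> Hom C Z X" using Zero_Hom ZO X by blast
  have "u \<bullet> f = Zero C Z X \<bullet> Zero C A Z" using z Comp_Zero[OF zX A] by simp
  then obtain v where "v \<in> Hom C D X" "v \<bullet> g = Id C X \<bullet> u"
    using TR3[OF t Dist_zero_Id[OF Z X] Zero_Hom[OF A ZO] u] by blast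
  then show ?thesis using that Id_left[OF u] by simp
qed

lemma Dist_Hom_zero_middle_right:
  assumes t: "Dist C A B D f g h" and X: "X \<in> Obj C"
    and "Hom C X A = {Zero C X A}" "Hom C X D = {Zero C X D}"
  shows "Hom C X B = {Zero C X B}"
proof -
  have "u = Zero C X B" if u: "u \<in> Hom C X B" for u
  proof -
    have "g \<bullet> u = Zero C X D" using Comp_Hom[OF u Dist_Hom(2)[OF t]] assms(4) by simp
    then obtain v where "v \<in> Hom C X A" "f \<bullet> v = u" using Dist_lift[OF t u] by blast
    then show ?thesis using assms(3) Comp_Zero[OF Dist_Hom(1)[OF t] X] by simp
  qed
  then show ?thesis using Hom_zero_iff X Dist_Obj[OF t] by metis
qed

lemma Dist_Hom_zero_middle_left:
  assumes t: "Dist C A B D f g h" and X: "X \<in> Obj C"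
    and "Hom C A X = {Zero C A X}" "Hom C D X = {Zero C D X}"
  shows "Hom C B X = {Zero C B X}"
proof -
  have "u = Zero C B X" if u: "u \<in> Hom C B X" for u
  proof -
    have "u \<bullet> f = Zero C A X" using Comp_Hom[OF Dist_Hom(1)[OF t] u] assms(3) by simp
    then obtain v where "v \<in> Hom C D X" "v \<bullet> g = u" using Dist_extend[OF t u] by blast
    then show ?thesis using assms(4) Zero_Comp[OF Dist_Hom(2)[OF t] X] by simp
  qed
  then show ?thesis using Hom_zero_iff X Dist_Obj[OF t] by metis
qed

text \<open>
  Idempotents with a given splitting always have a complement in a triangulated category: the
  connecting map \<open>h\<close> satisfies \<open>i[1] h = 0\<close>, hence vanishes as \<open>i[1]\<close> is a split monomorphism, and then
  \<open>q\<close> splits by exactness.  Closure under direct summands is phrased by biproducts, and this lemma makes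
  it applicable to retracts.
\<close>

lemma split_mono_biproduct:
  assumes t: "Dist C A P B i q h" and r: "r \<in> Hom C P A" and ri: "r \<bullet> i = Id C A"
  shows "is_biproduct C A B P"
proof -
  note i = Dist_Hom(1)[OF t] and q = Dist_Hom(2)[OF t] and h = Dist_Hom(3)[OF t]
    and A = Dist_Obj(1)[OF t] and P = Dist_Obj(2)[OF t] and B = Dist_Obj(3)[OF t]
  have "Neg C B (ShO C P) (ShM C i \<bullet> h) = Zero C B (ShO C P)"
    using Dist_comp_zero[OF Dist_rotate[OF Dist_rotate[OF t]]] Neg_Comp[OF h ShM_Hom[OF i]]
    by (rule trans[OF sym, rotated])
  then have nh: "ShM C i \<bullet> h = Zero C B (ShO C P)"
    using Neg_Neg[OF Comp_Hom[OF h ShM_Hom[OF i]]] Neg_Zero[OF B ShO_Obj[OF P]] by metis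
  have "h = ShM C (r \<bullet> i) \<bullet> h" using ri ShM_Id[OF A] Id_left[OF h] by simp
  also have "\<dots> = ShM C r \<bullet> (ShM C i \<bullet> h)"
    using ShM_Comp[OF i r] Comp_assoc[OF h ShM_Hom[OF i] ShM_Hom[OF r]] by simp
  also have "\<dots> = Zero C B (ShO C A)" using nh Comp_Zero[OF ShM_Hom[OF r] B] by simp
  finally have h0: "h = Zero C B (ShO C A)" .
  have "h \<bullet> Id C B = Zero C B (ShO C A)" using h0 Id_right[OF h] by simp
  then obtain s0 where s0: "s0 \<in> Hom C B P" and qs0: "q \<bullet> s0 = Id C B"
    using Dist_lift[OF Dist_rotate[OF t] Id_Hom[OF B]] by blast
  have qi: "q \<bullet> i = Zero C A B" by (rule Dist_comp_zero[OF t])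
  \<comment> \<open>Any section of \<open>q\<close> becomes one killed by \<open>r\<close> after subtracting its component along \<open>i\<close>.\<close>
  define e where "e = i \<bullet> (r \<bullet> s0)"
  have rs0: "r \<bullet> s0 \<in> Hom C B A" by (rule Comp_Hom[OF s0 r])
  have e: "e \<in> Hom C B P" unfolding e_def by (rule Comp_Hom[OF rs0 i])
  define s where "s = Add C s0 (Neg C B P e)"
  have s: "s \<in> Hom C B P" unfolding s_def by (rule Add_Hom[OF s0 Neg_Hom[OF e]])
  have qe: "q \<bullet> e = Zero C B B"
    unfolding e_def using Comp_assoc[OF rs0 i q] qi Zero_Comp[OF rs0 B] by simp
  have re: "r \<bullet> e = r \<bullet> s0"
    unfolding e_def using Comp_assoc[OF rs0 i r] ri Id_left[OF rs0] by simp
  have qs: "q \<bullet> s = Id C B"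
    unfolding s_def using Comp_Add_right[OF s0 Neg_Hom[OF e] q] Comp_Neg[OF e q] qe qs0
      Neg_Zero[OF B B] Add_Zero[OF Id_Hom[OF B]] by simp
  have rs: "r \<bullet> s = Zero C B A"
    unfolding s_def using Comp_Add_right[OF s0 Neg_Hom[OF e] r] Comp_Neg[OF e r] re
      Add_Neg[OF rs0] by simp
  note ir = Comp_Hom[OF r i] and sq = Comp_Hom[OF q s] and IP = Id_Hom[OF P]
  define c where "c = Add C (i \<bullet> r) (s \<bullet> q)"
  have c: "c \<in> Hom C P P" unfolding c_def by (rule Add_Hom[OF ir sq])
  have rc: "r \<bullet> c = r"
    unfolding c_def using Comp_Add_right[OF ir sq r] Comp_assoc[OF r i r] Comp_assoc[OF q s r]
      ri rs Id_left[OF r] Zero_Comp[OF q A] Add_Zero[OF r] by simp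
  have zq: "Zero C P B \<in> Hom C P B" by (rule Zero_Hom[OF P B])
  have qc: "q \<bullet> c = q"
    unfolding c_def using Comp_Add_right[OF ir sq q] Comp_assoc[OF r i q] Comp_assoc[OF q s q]
      qi qs Id_left[OF q] Zero_Comp[OF r B] Add_Zero[OF q] Add_commute[OF zq q] by simp
  \<comment> \<open>The difference \<open>k = c - id\<close> is killed by \<open>q\<close> and hence factors through \<open>i\<close>; the factor is
    \<open>r k\<close>, which vanishes as well.\<close>
  define k where "k = Add C c (Neg C P P (Id C P))"
  have k: "k \<in> Hom C P P" unfolding k_def by (rule Add_Hom[OF c Neg_Hom[OF IP]])
  have "q \<bullet> k = Zero C P B"
    unfolding k_def using Comp_Add_right[OF c Neg_Hom[OF IP] q] Comp_Neg[OF IP q] qc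
      Id_right[OF q] Add_Neg[OF q] by simp
  then obtain v where v: "v \<in> Hom C P A" and iv: "i \<bullet> v = k" using Dist_lift[OF t k] by blast
  have "v = r \<bullet> k" using iv Comp_assoc[OF v i r] ri Id_left[OF v] by simp
  also have "r \<bullet> k = Zero C P A"
    unfolding k_def using Comp_Add_right[OF c Neg_Hom[OF IP] r] Comp_Neg[OF IP r] rc
      Id_right[OF r] Add_Neg[OF r] by simp
  finally have "k = Zero C P P" using iv Comp_Zero[OF i P] by simp
  then have "c = Id C P" using eq_if_diff_Zero[OF c IP] unfolding k_def by simp
  then show ?thesis
    unfolding is_biproduct_def using i s r q ri qs qi rs unfolding c_def by blast
qed

text \<open>
  A cone of \<open>k\<close> is isomorphic to some \<open>U[1]\<close>; replacing it by \<open>U[1]\<close> allows to rotate back.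
\<close>

lemma Dist_cocone:
  assumes k: "k \<in> Hom C A W"
  obtains U f h where "Dist C U A W f k h"
proof -
  obtain Y k' k'' where t: "Dist C A W Y k k' k''" using TR1_cone[OF k] by blast
  note k' = Dist_Hom(2)[OF t] and k'' = Dist_Hom(3)[OF t]
    and A = Dist_Obj(1)[OF t] and W = Dist_Obj(2)[OF t] and Y = Dist_Obj(3)[OF t]
  obtain U \<phi> where U: "U \<in> Obj C" and \<phi>i: "is_iso C (ShO C U) Y \<phi>" using ShO_ess_surj[OF Y] .
  obtain \<psi> where \<psi>i: "is_iso C Y (ShO C U) \<psi>" and \<psi>\<phi>: "\<psi> \<bullet> \<phi> = Id C (ShO C U)"
    and \<phi>\<psi>: "\<phi> \<bullet> \<psi> = Id C Y"
    using is_iso_inverse[OF \<phi>i] by blast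
  note \<phi> = is_iso_Hom[OF \<phi>i] and \<psi> = is_iso_Hom[OF \<psi>i]
  note l = Comp_Hom[OF k' \<psi>] and m = Comp_Hom[OF \<phi> k'']
  have "is_triangle C A W (ShO C U) k (\<psi> \<bullet> k') (k'' \<bullet> \<phi>)"
    unfolding is_triangle_def using k l m by blast
  moreover have "triangles_isomorphic C A W Y k k' k'' A W (ShO C U) k (\<psi> \<bullet> k') (k'' \<bullet> \<phi>)"
    unfolding triangles_isomorphic_def
  proof (intro exI conjI)
    show "is_iso C A A (Id C A)" "is_iso C W W (Id C W)" using is_iso_Id A W by blast+
    show "is_iso C Y (ShO C U) \<psi>" by (rule \<psi>i)
    show "Id C W \<bullet> k = k \<bullet> Id C A" using Id_left[OF k] Id_right[OF k] by simp
    show "\<psi> \<bullet> k' = \<psi> \<bullet> k' \<bullet> Id C W" using Id_right[OF l] by simp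
    show "ShM C (Id C A) \<bullet> k'' = k'' \<bullet> \<phi> \<bullet> \<psi>"
      using ShM_Id[OF A] Id_left[OF k''] Comp_assoc[OF \<psi> \<phi> k''] \<phi>\<psi> Id_right[OF k''] by simp
  qed
  ultimately have t': "Dist C A W (ShO C U) k (\<psi> \<bullet> k') (k'' \<bullet> \<phi>)" using TR1_iso[OF t] by blast
  obtain f where f: "f \<in> Hom C U A" and sf: "ShM C f = Neg C (ShO C U) (ShO C A) (k'' \<bullet> \<phi>)"
    using ShM_full[OF Neg_Hom[OF m] U A] .
  have tri: "is_triangle C U A W f k (\<psi> \<bullet> k')" unfolding is_triangle_def using f k l by blast
  have "Neg C (ShO C U) (ShO C A) (ShM C f) = k'' \<bullet> \<phi>" using sf Neg_Neg[OF m] by simp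
  then have "Dist C U A W f k (\<psi> \<bullet> k')" using TR2[OF tri] t' by simp
  then show ?thesis by (rule that)
qed

text \<open>
  Rotating a triangle three times shifts its objects and negates the shifts of its three maps; the
  maps of the unshifted triangle are therefore preimages of \<open>-f\<close>, \<open>-g\<close>, \<open>-h\<close>.
\<close>

lemma Dist_unshift:
  assumes t: "Dist C (ShO C A) (ShO C B) (ShO C D) f g h"
    and A: "A \<in> Obj C" and B: "B \<in> Obj C" and D: "D \<in> Obj C"
  obtains f' g' h' where "Dist C A B D f' g' h'"
proof -
  note f = Dist_Hom(1)[OF t] and g = Dist_Hom(2)[OF t] and h = Dist_Hom(3)[OF t]
  note sA = ShO_Obj[OF A]
  obtain f' where f': "f' \<in> Hom C A B" "ShM C f' = Neg C (ShO C A) (ShO C B) f"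
    using ShM_full[OF Neg_Hom[OF f] A B] .
  obtain g' where g': "g' \<in> Hom C B D" "ShM C g' = Neg C (ShO C B) (ShO C D) g"
    using ShM_full[OF Neg_Hom[OF g] B D] .
  obtain h' where h': "h' \<in> Hom C D (ShO C A)" "ShM C h' = Neg C (ShO C D) (ShO C (ShO C A)) h"
    using ShM_full[OF Neg_Hom[OF h] D sA] .
  have e: "Neg C (ShO C A) (ShO C B) (ShM C f') = f" "Neg C (ShO C B) (ShO C D) (ShM C g') = g"
    "Neg C (ShO C D) (ShO C (ShO C A)) (ShM C h') = h"
    using f'(2) g'(2) h'(2) Neg_Neg f g h by simp_all
  have "Dist C D (ShO C A) (ShO C B) h' f g"
    using TR2[of D "ShO C A" "ShO C B" h' f g] t e h' f g by (simp add: is_triangle_def)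
  then have "Dist C B D (ShO C A) g' h' f"
    using TR2[of B D "ShO C A" g' h' f] e h' f g' by (simp add: is_triangle_def)
  then have "Dist C A B D f' g' h'"
    using TR2[of A B D f' g' h'] e h' f' g' by (simp add: is_triangle_def)
  then show ?thesis by (rule that)
qed

lemma Dist_iso_ends:
  assumes t: "Dist C A B D f g h" and a: "is_iso C A' A \<alpha>" and d: "is_iso C D' D \<delta>"
  obtains f' g' h' where "Dist C A' B D' f' g' h'"
proof -
  note f = Dist_Hom(1)[OF t] and g = Dist_Hom(2)[OF t] and h = Dist_Hom(3)[OF t]
    and B = Dist_Obj(2)[OF t]
  obtain \<alpha>' where \<alpha>'i: "is_iso C A A' \<alpha>'" and \<alpha>: "\<alpha> \<bullet> \<alpha>' = Id C A"
    using is_iso_inverse[OF a] by blast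
  obtain \<delta>' where \<delta>'i: "is_iso C D D' \<delta>'" and \<delta>: "\<delta> \<bullet> \<delta>' = Id C D"
    using is_iso_inverse[OF d] by blast
  note ah = is_iso_Hom[OF a] and dh = is_iso_Hom[OF d]
    and a'h = is_iso_Hom[OF \<alpha>'i] and d'h = is_iso_Hom[OF \<delta>'i]
  note hd = Comp_Hom[OF dh h] and sa = ShM_Hom[OF a'h]
  have "is_triangle C A' B D' (f \<bullet> \<alpha>) (\<delta>' \<bullet> g) (ShM C \<alpha>' \<bullet> (h \<bullet> \<delta>))"
    unfolding is_triangle_def using Comp_Hom[OF ah f] Comp_Hom[OF g d'h] Comp_Hom[OF hd sa] by blast
  moreover have "triangles_isomorphic C A B D f g h A' B D' (f \<bullet> \<alpha>) (\<delta>' \<bullet> g) (ShM C \<alpha>' \<bullet> (h \<bullet> \<delta>))"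
    unfolding triangles_isomorphic_def
  proof (intro exI conjI)
    show "is_iso C A A' \<alpha>'" "is_iso C D D' \<delta>'" "is_iso C B B (Id C B)"
      using \<alpha>'i \<delta>'i is_iso_Id[OF B] by blast+
    show "Id C B \<bullet> f = f \<bullet> \<alpha> \<bullet> \<alpha>'"
      using Id_left[OF f] Comp_assoc[OF a'h ah f] \<alpha> Id_right[OF f] by simp
    show "\<delta>' \<bullet> g = \<delta>' \<bullet> g \<bullet> Id C B" using Id_right[OF Comp_Hom[OF g d'h]] by simp
    show "ShM C \<alpha>' \<bullet> h = ShM C \<alpha>' \<bullet> (h \<bullet> \<delta>) \<bullet> \<delta>'"
      using Comp_assoc[OF d'h hd sa] Comp_assoc[OF d'h dh h] \<delta> Id_right[OF h] by simp
  qed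
  ultimately show ?thesis using TR1_iso[OF t] that by blast
qed

end

section \<open>Adjunctions and full subcategories\<close>

lemma is_functorD:
  assumes "is_functor C D F"
  shows "A \<in> Obj C \<Longrightarrow> FO F A \<in> Obj D"
    and "f \<in> Hom C A B \<Longrightarrow> FM F f \<in> Hom D (FO F A) (FO F B)"
    and "f \<in> Hom C A B \<Longrightarrow> g \<in> Hom C B E \<Longrightarrow> FM F (g \<bullet>\<^bsub>C\<^esub> f) = FM F g \<bullet>\<^bsub>D\<^esub> FM F f"
  using assms unfolding is_functor_def by simp_all

lemma adjunctionD:
  assumes "adjunction C D F G \<eta> \<epsilon>"
  shows "is_functor C D F" and "is_functor D C G"
    and "A \<in> Obj C \<Longrightarrow> \<eta> A \<in> Hom C A (FO G (FO F A))"
    and "f \<in> Hom C A B \<Longrightarrow> FM G (FM F f) \<bullet>\<^bsub>C\<^esub> \<eta> A = \<eta> B \<bullet>\<^bsub>C\<^esub> f"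
    and "X \<in> Obj D \<Longrightarrow> \<epsilon> X \<in> Hom D (FO F (FO G X)) X"
    and "g \<in> Hom D X Y \<Longrightarrow> \<epsilon> Y \<bullet>\<^bsub>D\<^esub> FM F (FM G g) = g \<bullet>\<^bsub>D\<^esub> \<epsilon> X"
    and "A \<in> Obj C \<Longrightarrow> \<epsilon> (FO F A) \<bullet>\<^bsub>D\<^esub> FM F (\<eta> A) = Id D (FO F A)"
    and "X \<in> Obj D \<Longrightarrow> FM G (\<epsilon> X) \<bullet>\<^bsub>C\<^esub> \<eta> (FO G X) = Id C (FO G X)"
  using assms unfolding adjunction_def by simp_all

text \<open>
  The map \<open>f\<close> is the transpose of its own transpose \<open>\<epsilon>\<^sub>Y F(f)\<close>, so it depends only on \<open>F(f)\<close>.  The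
  computation takes place in \<open>C\<close>; when \<open>D\<close> is a Verdier quotient, the composition of roofs is never expanded.
\<close>

lemma adjunction_transpose_unit:
  assumes "category C" and adj: "adjunction C D F G \<eta> \<epsilon>"
    and f: "f \<in> Hom C A (FO G Y)" and Y: "Y \<in> Obj D"
  shows "f = FM G (\<epsilon> Y \<bullet>\<^bsub>D\<^esub> FM F f) \<bullet>\<^bsub>C\<^esub> \<eta> A"
proof -
  interpret category C by fact
  note A = Hom_Obj[OF f, THEN conjunct1] and GY = Hom_Obj[OF f, THEN conjunct2]
  note F = is_functorD[OF adjunctionD(1)[OF adj]] and G = is_functorD[OF adjunctionD(2)[OF adj]]
  note eY = adjunctionD(5)[OF adj Y] and Ff = F(2)[OF f]
    and \<eta>A = adjunctionD(3)[OF adj A] and \<eta>Y = adjunctionD(3)[OF adj GY]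
  note GeY = G(2)[OF eY] and GFf = G(2)[OF Ff]
  have "FM G (\<epsilon> Y \<bullet>\<^bsub>D\<^esub> FM F f) \<bullet>\<^bsub>C\<^esub> \<eta> A = FM G (\<epsilon> Y) \<bullet>\<^bsub>C\<^esub> (FM G (FM F f) \<bullet>\<^bsub>C\<^esub> \<eta> A)"
    using G(3)[OF Ff eY] Comp_assoc[OF \<eta>A GFf GeY] by simp
  also have "\<dots> = FM G (\<epsilon> Y) \<bullet>\<^bsub>C\<^esub> \<eta> (FO G Y) \<bullet>\<^bsub>C\<^esub> f"
    using adjunctionD(4)[OF adj f] Comp_assoc[OF f \<eta>Y GeY] by simp
  also have "\<dots> = f" using adjunctionD(8)[OF adj Y] Id_left[OF f] by simp
  finally show ?thesis by simp
qed

text \<open>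
  Dually, \<open>f\<close> depends only on \<open>G(f)\<close>, by a computation in \<open>D\<close>.
\<close>

lemma adjunction_transpose_counit:
  assumes "category D" and adj: "adjunction C D F G \<eta> \<epsilon>"
    and f: "f \<in> Hom D (FO F A) Y" and A: "A \<in> Obj C"
  shows "f = \<epsilon> Y \<bullet>\<^bsub>D\<^esub> FM F (FM G f \<bullet>\<^bsub>C\<^esub> \<eta> A)"
proof -
  interpret category D by fact
  note Y = Hom_Obj[OF f, THEN conjunct2] and FA = Hom_Obj[OF f, THEN conjunct1]
  note F = is_functorD[OF adjunctionD(1)[OF adj]] and G = is_functorD[OF adjunctionD(2)[OF adj]]
  note eY = adjunctionD(5)[OF adj Y] and Gf = G(2)[OF f]
    and \<eta>A = adjunctionD(3)[OF adj A] and eA = adjunctionD(5)[OF adj FA]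
  note F\<eta>A = F(2)[OF \<eta>A] and FGf = F(2)[OF Gf]
  have "\<epsilon> Y \<bullet>\<^bsub>D\<^esub> FM F (FM G f \<bullet>\<^bsub>C\<^esub> \<eta> A) = \<epsilon> Y \<bullet>\<^bsub>D\<^esub> FM F (FM G f) \<bullet>\<^bsub>D\<^esub> FM F (\<eta> A)"
    using F(3)[OF \<eta>A Gf] Comp_assoc[OF F\<eta>A FGf eY] by simp
  also have "\<dots> = f \<bullet>\<^bsub>D\<^esub> (\<epsilon> (FO F A) \<bullet>\<^bsub>D\<^esub> FM F (\<eta> A))"
    using adjunctionD(6)[OF adj f] Comp_assoc[OF F\<eta>A eA f] by simp
  also have "\<dots> = f" using adjunctionD(7)[OF adj A] Id_right[OF f] by simp
  finally show ?thesis by simp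
qed

lemma zero_object_unique:
  assumes "zero_object C Z" "A \<in> Obj C"
  shows "f \<in> Hom C A Z \<Longrightarrow> g \<in> Hom C A Z \<Longrightarrow> f = g"
    and "f \<in> Hom C Z A \<Longrightarrow> g \<in> Hom C Z A \<Longrightarrow> f = g"
  using assms unfolding zero_object_def by blast+

lemma FO_inclusion [simp]: "FO (inclusion C N) A = A"
  and FM_inclusion [simp]: "FM (inclusion C N) f = f"
  by (simp_all add: inclusion_def)

lemma full_subcategory_simps [simp]:
  "Obj (full_subcategory C N) = N"
  "Hom (full_subcategory C N) A B = (if A \<in> N \<and> B \<in> N then Hom C A B else {})"
  "Id (full_subcategory C N) = Id C" "Comp (full_subcategory C N) = Comp C"
  "Add (full_subcategory C N) = Add C" "Zero (full_subcategory C N) = Zero C"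
  "Shift (full_subcategory C N) = Shift C"
  "Dist (full_subcategory C N) A B D f g h \<longleftrightarrow> A \<in> N \<and> B \<in> N \<and> D \<in> N \<and> Dist C A B D f g h"
  by (simp_all add: full_subcategory_def)

lemma (in triangulated_category) category_full_subcategory:
  assumes "N \<subseteq> Obj C"
  shows "category (full_subcategory C N)"
proof (rule category.intro, goal_cases)
  case 2 then show ?case using Hom_disjoint by (simp split: if_splits)
next
  case 3 then show ?case using assms Id_Hom by auto
next
  case 4 then show ?case using Comp_Hom by (simp split: if_splits)
next
  case 5 then show ?case using Id_left by (simp split: if_splits)
next
  case 6 then show ?case using Id_right by (simp split: if_splits)
next
  case 7 then show ?case using Comp_assoc by (simp split: if_splits)
qed (simp split: if_splits)

lemma is_iso_full_subcategory:
  "A \<in> N \<Longrightarrow> B \<in> N \<Longrightarrow> is_iso (full_subcategory C N) A B f \<longleftrightarrow> is_iso C A B f"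
  by (simp add: is_iso_def)

lemma iso_objects_full_subcategory:
  "A \<in> N \<Longrightarrow> B \<in> N \<Longrightarrow> iso_objects (full_subcategory C N) A B \<longleftrightarrow> iso_objects C A B"
  by (simp add: iso_objects_def is_iso_full_subcategory)

lemma is_biproduct_full_subcategory:
  "A \<in> N \<Longrightarrow> B \<in> N \<Longrightarrow> P \<in> N \<Longrightarrow>
    is_biproduct (full_subcategory C N) A B P \<longleftrightarrow> is_biproduct C A B P"
  by (simp add: is_biproduct_def)

section \<open>Hom-vanishing in a recollement\<close>

context recollement
begin

lemma N_Obj: "A \<in> N \<Longrightarrow> A \<in> Obj C"
  using subcategory unfolding triangulated_subcategory_def full_additive_subcategory_def by blast

lemma N_iso: "A \<in> N \<Longrightarrow> iso_objects C A B \<Longrightarrow> B \<in> N"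
  using subcategory unfolding triangulated_subcategory_def closed_under_iso_def by blast

lemma N_ShO_iff: "A \<in> Obj C \<Longrightarrow> ShO C A \<in> N \<longleftrightarrow> A \<in> N"
  using subcategory unfolding triangulated_subcategory_def by blast

lemma N_cone: "Dist C A B D f g h \<Longrightarrow> A \<in> N \<Longrightarrow> B \<in> N \<Longrightarrow> D \<in> N"
  using subcategory unfolding triangulated_subcategory_def by blast

lemma N_extension:
  assumes t: "Dist C A B D f g h" and "A \<in> N" "D \<in> N"
  shows "B \<in> N"
  using N_cone[OF Dist_rotate[OF Dist_rotate[OF t]]] N_ShO_iff assms(2,3) Dist_Obj[OF t] by blast

lemma category_N: "category (full_subcategory C N)"
  using category_full_subcategory N_Obj by blast

lemma iL_N: "A \<in> Obj C \<Longrightarrow> FO iL A \<in> N"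
  and iR_N: "A \<in> Obj C \<Longrightarrow> FO iR A \<in> N"
  using is_functorD(1)[OF adjunctionD(1)[OF adjunction_iL]]
    is_functorD(1)[OF adjunctionD(2)[OF adjunction_iR]] by simp_all

lemma unit_Hom: "A \<in> Obj C \<Longrightarrow> \<eta>_iL A \<in> Hom C A (FO iL A)"
  and counit_Hom: "A \<in> Obj C \<Longrightarrow> \<epsilon>_iR A \<in> Hom C (FO iR A) A"
  using adjunctionD(3)[OF adjunction_iL] adjunctionD(5)[OF adjunction_iR] by simp_all

lemma reflection_factor:
  assumes f: "f \<in> Hom C A X" and X: "X \<in> N"
  obtains g where "g \<in> Hom C (FO iL A) X" "g \<bullet> \<eta>_iL A = f"
proof -
  have A: "A \<in> Obj C" using f Hom_Obj by blast
  have "\<epsilon>_iL X \<in> Hom C (FO iL X) X" and "FM iL f \<in> Hom C (FO iL A) (FO iL X)"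
    using adjunctionD(5)[OF adjunction_iL, of X] is_functorD(2)[OF adjunctionD(1)[OF adjunction_iL] f]
      X iL_N[OF A] iL_N[OF N_Obj[OF X]] by simp_all
  then have "\<epsilon>_iL X \<bullet> FM iL f \<in> Hom C (FO iL A) X" using Comp_Hom by blast
  moreover have "\<epsilon>_iL X \<bullet> FM iL f \<bullet> \<eta>_iL A = f"
    using adjunction_transpose_unit[OF category_axioms adjunction_iL, of f A X] f X by simp
  ultimately show ?thesis using that by blast
qed

lemma reflection_unique:
  assumes "f \<in> Hom C (FO iL A) X" "g \<in> Hom C (FO iL A) X" "A \<in> Obj C" "X \<in> N"
    and "f \<bullet> \<eta>_iL A = g \<bullet> \<eta>_iL A"
  shows "f = g"
  using adjunction_transpose_counit[OF category_N adjunction_iL _ assms(3), of f X]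
    adjunction_transpose_counit[OF category_N adjunction_iL _ assms(3), of g X] assms iL_N by simp

lemma coreflection_factor:
  assumes f: "f \<in> Hom C X A" and X: "X \<in> N"
  obtains g where "g \<in> Hom C X (FO iR A)" "\<epsilon>_iR A \<bullet> g = f"
proof -
  have A: "A \<in> Obj C" using f Hom_Obj by blast
  have "\<eta>_iR X \<in> Hom C X (FO iR X)" and "FM iR f \<in> Hom C (FO iR X) (FO iR A)"
    using adjunctionD(3)[OF adjunction_iR, of X] is_functorD(2)[OF adjunctionD(2)[OF adjunction_iR] f]
      X iR_N[OF A] iR_N[OF N_Obj[OF X]] by simp_all
  then have "FM iR f \<bullet> \<eta>_iR X \<in> Hom C X (FO iR A)" using Comp_Hom by blast
  moreover have "\<epsilon>_iR A \<bullet> (FM iR f \<bullet> \<eta>_iR X) = f"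
    using adjunction_transpose_counit[OF category_axioms adjunction_iR, of f X A] f X by simp
  ultimately show ?thesis using that by blast
qed

lemma coreflection_unique:
  assumes "f \<in> Hom C X (FO iR A)" "g \<in> Hom C X (FO iR A)" "A \<in> Obj C" "X \<in> N"
    and "\<epsilon>_iR A \<bullet> f = \<epsilon>_iR A \<bullet> g"
  shows "f = g"
  using adjunction_transpose_unit[OF category_N adjunction_iR _ assms(3), of f X]
    adjunction_transpose_unit[OF category_N adjunction_iR _ assms(3), of g X] assms iR_N by simp

text \<open>
  For \<open>X \<in> N\<close>, precomposition with the unit is a bijection from \<open>\<C>(i\<^sup>*A, X)\<close> to \<open>\<C>(A, X)\<close>.
\<close>

lemma Hom_zero_reflection:
  assumes A: "A \<in> Obj C" and X: "X \<in> N"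
  shows "Hom C (FO iL A) X = {Zero C (FO iL A) X} \<longleftrightarrow> Hom C A X = {Zero C A X}"
proof
  note XO = N_Obj[OF X] and L = N_Obj[OF iL_N[OF A]]
  assume l: "Hom C (FO iL A) X = {Zero C (FO iL A) X}"
  have "f = Zero C A X" if f: "f \<in> Hom C A X" for f
  proof -
    obtain g where "g \<in> Hom C (FO iL A) X" "g \<bullet> \<eta>_iL A = f" using reflection_factor[OF f X] .
    then show ?thesis using l Zero_Comp[OF unit_Hom[OF A] XO] by simp
  qed
  then show "Hom C A X = {Zero C A X}" using Hom_zero_iff[OF A XO] by blast
next
  note XO = N_Obj[OF X] and L = N_Obj[OF iL_N[OF A]]
  assume r: "Hom C A X = {Zero C A X}"
  have "f = Zero C (FO iL A) X" if f: "f \<in> Hom C (FO iL A) X" for f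
  proof (rule reflection_unique[OF f Zero_Hom[OF L XO] A X])
    show "f \<bullet> \<eta>_iL A = Zero C (FO iL A) X \<bullet> \<eta>_iL A"
      using Zero_Comp[OF unit_Hom[OF A] XO] Comp_Hom[OF unit_Hom[OF A] f] r by simp
  qed
  then show "Hom C (FO iL A) X = {Zero C (FO iL A) X}" using Hom_zero_iff[OF L XO] by blast
qed

text \<open>
  For \<open>X \<in> N\<close>, postcomposition with the counit is a bijection from \<open>\<C>(X, i\<^sup>!A)\<close> to \<open>\<C>(X, A)\<close>.
\<close>

lemma Hom_zero_coreflection:
  assumes A: "A \<in> Obj C" and X: "X \<in> N"
  shows "Hom C X (FO iR A) = {Zero C X (FO iR A)} \<longleftrightarrow> Hom C X A = {Zero C X A}"
proof
  note XO = N_Obj[OF X] and R = N_Obj[OF iR_N[OF A]]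
  assume l: "Hom C X (FO iR A) = {Zero C X (FO iR A)}"
  have "f = Zero C X A" if f: "f \<in> Hom C X A" for f
  proof -
    obtain g where "g \<in> Hom C X (FO iR A)" "\<epsilon>_iR A \<bullet> g = f" using coreflection_factor[OF f X] .
    then show ?thesis using l Comp_Zero[OF counit_Hom[OF A] XO] by simp
  qed
  then show "Hom C X A = {Zero C X A}" using Hom_zero_iff[OF XO A] by blast
next
  note XO = N_Obj[OF X] and R = N_Obj[OF iR_N[OF A]]
  assume r: "Hom C X A = {Zero C X A}"
  have "f = Zero C X (FO iR A)" if f: "f \<in> Hom C X (FO iR A)" for f
  proof (rule coreflection_unique[OF f Zero_Hom[OF XO R] A X])
    show "\<epsilon>_iR A \<bullet> f = \<epsilon>_iR A \<bullet> Zero C X (FO iR A)"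
      using Comp_Zero[OF counit_Hom[OF A] XO] Comp_Hom[OF f counit_Hom[OF A]] r by simp
  qed
  then show "Hom C X (FO iR A) = {Zero C X (FO iR A)}" using Hom_zero_iff[OF XO R] by blast
qed

text \<open>
  A reflective subcategory is closed under retracts: the section \<open>i\<close> factors as \<open>k \<eta>\<close> through the unit of \<open>A\<close>,
  and \<open>p k\<close> is then inverse to \<open>\<eta>\<close>, on one side since \<open>p i = id\<close> and on the other by uniqueness of factorizations
  through \<open>\<eta>\<close>.
\<close>

lemma N_retract:
  assumes i: "i \<in> Hom C A P" and p: "p \<in> Hom C P A" and pi: "p \<bullet> i = Id C A" and P: "P \<in> N"
  shows "A \<in> N"
proof -
  note A = Hom_Obj[OF i, THEN conjunct1]
  note u = unit_Hom[OF A] and L = iL_N[OF A]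
  obtain k where k: "k \<in> Hom C (FO iL A) P" and ki: "k \<bullet> \<eta>_iL A = i"
    using reflection_factor[OF i P] .
  note pk = Comp_Hom[OF k p]
  have one: "p \<bullet> k \<bullet> \<eta>_iL A = Id C A" using Comp_assoc[OF u k p] ki pi by simp
  have "\<eta>_iL A \<bullet> (p \<bullet> k) = Id C (FO iL A)"
  proof (rule reflection_unique[OF Comp_Hom[OF pk u] Id_Hom[OF N_Obj[OF L]] A L])
    show "\<eta>_iL A \<bullet> (p \<bullet> k) \<bullet> \<eta>_iL A = Id C (FO iL A) \<bullet> \<eta>_iL A"
      using Comp_assoc[OF u pk u] one Id_right[OF u] Id_left[OF u] by simp
  qed
  then have "is_iso C (FO iL A) A (p \<bullet> k)" unfolding is_iso_def using pk u one by blast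
  then show ?thesis using N_iso[OF L] unfolding iso_objects_def by blast
qed

lemma N_biproduct: "is_biproduct C A B P \<Longrightarrow> P \<in> N \<Longrightarrow> A \<in> N \<and> B \<in> N"
  unfolding is_biproduct_def using N_retract by blast

text \<open>
  Closure under summands is the delicate point: the summands formed in \<open>C\<close> lie in \<open>N\<close>, as \<open>N\<close> is thick.
\<close>

lemma additive_in_N_in_C:
  assumes "full_additive_subcategory (full_subcategory C N) X"
    "closed_under_iso (full_subcategory C N) X" "closed_under_summands (full_subcategory C N) X"
  shows "full_additive_subcategory C X" "closed_under_iso C X" "closed_under_summands C X"
proof -
  have XN: "X \<subseteq> N" using assms(1) unfolding full_additive_subcategory_def by simp
  obtain Z where Z: "Z \<in> X" "zero_object (full_subcategory C N) Z"
    using assms(1) unfolding full_additive_subcategory_def by blast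
  then have ZN: "Z \<in> N" using XN by blast
  then have "\<exists>!f. f \<in> Hom C Z Z" using Z(2) unfolding zero_object_def by simp
  then have "Id C Z = Zero C Z Z" using Id_Hom Zero_Hom N_Obj[OF ZN] by blast
  then have "zero_object C Z" using zero_object_iff N_Obj[OF ZN] by blast
  moreover have "\<exists>P \<in> X. is_biproduct C A B P" if "A \<in> X" "B \<in> X" for A B
    using assms(1) that XN is_biproduct_full_subcategory
    unfolding full_additive_subcategory_def by (metis subsetD)
  ultimately show "full_additive_subcategory C X"
    unfolding full_additive_subcategory_def using Z(1) XN N_Obj by blast
  show "closed_under_iso C X"
    using assms(2) XN N_iso iso_objects_full_subcategory
    unfolding closed_under_iso_def by (metis subsetD)
  show "closed_under_summands C X"
    using assms(3) XN N_biproduct is_biproduct_full_subcategory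
    unfolding closed_under_summands_def by (metis subsetD)
qed

text \<open>
  A map from \<open>X\<close> to \<open>j\<^sub>*Y\<close> is determined by its image under \<open>\<ell>\<close>, and that is a map out of the zero object \<open>\<ell>X\<close>.
\<close>

lemma Hom_N_jR_zero:
  assumes X: "X \<in> N" and Y: "Y \<in> Obj (Verdier_quotient C N)"
  shows "Hom C X (FO jR Y) = {Zero C X (FO jR Y)}"
proof -
  let ?l = "quotient_functor C N"
  note F = adjunctionD(1)[OF adjunction_jR]
  have jR: "FO jR Y \<in> Obj C" by (rule is_functorD(1)[OF adjunctionD(2)[OF adjunction_jR] Y])
  note lY = is_functorD(1)[OF F jR]
  have "f = g" if f: "f \<in> Hom C X (FO jR Y)" and g: "g \<in> Hom C X (FO jR Y)" for f g
  proof -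
    have "FM ?l f \<in> Hom (Verdier_quotient C N) (FO ?l X) (FO ?l (FO jR Y))"
      "FM ?l g \<in> Hom (Verdier_quotient C N) (FO ?l X) (FO ?l (FO jR Y))"
      using is_functorD(2)[OF F] f g by blast+
    then have "FM ?l f = FM ?l g"
      using zero_object_unique(2)[OF quotient_vanishes[OF X] lY] by simp
    then show ?thesis
      using adjunction_transpose_unit[OF category_axioms adjunction_jR f Y]
        adjunction_transpose_unit[OF category_axioms adjunction_jR g Y] by simp
  qed
  then show ?thesis using Zero_Hom[OF N_Obj[OF X] jR] by blast
qed

lemma Hom_jL_N_zero:
  assumes X: "X \<in> N" and Y: "Y \<in> Obj (Verdier_quotient C N)"
  shows "Hom C (FO jL Y) X = {Zero C (FO jL Y) X}"
proof -
  let ?l = "quotient_functor C N"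
  note F = adjunctionD(2)[OF adjunction_jL]
  have jL: "FO jL Y \<in> Obj C" by (rule is_functorD(1)[OF adjunctionD(1)[OF adjunction_jL] Y])
  note lY = is_functorD(1)[OF F jL]
  have "f = g" if f: "f \<in> Hom C (FO jL Y) X" and g: "g \<in> Hom C (FO jL Y) X" for f g
  proof -
    have "FM ?l f \<in> Hom (Verdier_quotient C N) (FO ?l (FO jL Y)) (FO ?l X)"
      "FM ?l g \<in> Hom (Verdier_quotient C N) (FO ?l (FO jL Y)) (FO ?l X)"
      using is_functorD(2)[OF F] f g by blast+
    then have "FM ?l f = FM ?l g"
      using zero_object_unique(1)[OF quotient_vanishes[OF X] lY] by simp
    then show ?thesis
      using adjunction_transpose_counit[OF category_axioms adjunction_jL f Y]
        adjunction_transpose_counit[OF category_axioms adjunction_jL g Y] by simp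
  qed
  then show ?thesis using Zero_Hom[OF jL N_Obj[OF X]] by blast
qed

lemma quotient_Obj: "A \<in> Obj C \<Longrightarrow> FO (quotient_functor C N) A \<in> Obj (Verdier_quotient C N)"
  by (rule is_functorD(1)[OF adjunctionD(1)[OF adjunction_jR]])

end

section \<open>Extending a cotorsion pair along a recollement\<close>

locale recollement_with_cotorsion_pair = recollement +
  fixes S V
  assumes cotorsion_pair_N: "cotorsion_pair (full_subcategory C N) (S, V)"
begin

lemma S_N: "A \<in> S \<Longrightarrow> A \<in> N" and V_N: "A \<in> V \<Longrightarrow> A \<in> N"
  using cotorsion_pair_N unfolding cotorsion_pair_def full_additive_subcategory_def by auto

lemma shift_up_V_N:
  assumes "W \<in> shift_up C V" shows "W \<in> N"
proof -
  obtain B where "B \<in> V" "iso_objects C W (ShO C B)" using assms unfolding shift_up_def by blast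
  then show ?thesis using N_iso iso_objects_sym N_ShO_iff V_N N_Obj by metis
qed

lemma shift_down_S_N:
  assumes "A \<in> shift_down C S" shows "A \<in> N"
proof -
  obtain B where "B \<in> S" "iso_objects C (ShO C A) B" "A \<in> Obj C"
    using assms unfolding shift_down_def by blast
  then show ?thesis using N_iso iso_objects_sym N_ShO_iff S_N N_Obj by metis
qed

lemma S_additive:
  "full_additive_subcategory C S" "closed_under_iso C S" "closed_under_summands C S"
  using additive_in_N_in_C[of S] cotorsion_pair_N unfolding cotorsion_pair_def by simp_all

lemma V_additive:
  "full_additive_subcategory C V" "closed_under_iso C V" "closed_under_summands C V"
  using additive_in_N_in_C[of V] cotorsion_pair_N unfolding cotorsion_pair_def by simp_all

lemma N_decomposition:
  assumes "A \<in> N"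
  obtains S0 W f g h where "S0 \<in> S" "W \<in> shift_up C V" "Dist C S0 A W f g h"
proof -
  have "A \<in> star (full_subcategory C N) S (shift_up (full_subcategory C N) V)"
    using cotorsion_pair_N assms unfolding cotorsion_pair_def by simp
  then obtain S0 W f g h where S0: "S0 \<in> S" and W: "W \<in> shift_up (full_subcategory C N) V"
    and t: "Dist C S0 A W f g h"
    unfolding star_def by auto
  obtain B where B: "W \<in> N" "B \<in> V" "iso_objects (full_subcategory C N) W (ShO C B)"
    using W unfolding shift_up_def by auto
  then have "iso_objects C W (ShO C B)"
    using iso_objects_full_subcategory N_ShO_iff V_N N_Obj by metis
  then have "W \<in> shift_up C V" unfolding shift_up_def using B N_Obj by blast
  then show ?thesis using that S0 t by blast
qed

lemma Ext1_S_V: "Ext1_vanishes C S V"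
proof -
  have "Hom C A (ShO C B) = {Zero C A (ShO C B)}" if "A \<in> S" "B \<in> V" for A B
  proof -
    have "ShO C B \<in> N" "A \<in> N" using N_ShO_iff V_N N_Obj S_N that by blast+
    moreover have "Hom (full_subcategory C N) A (ShO C B) = {Zero C A (ShO C B)}"
      using cotorsion_pair_N that unfolding cotorsion_pair_def Ext1_vanishes_def Ext1_def by simp
    ultimately show ?thesis by simp
  qed
  then show ?thesis unfolding Ext1_vanishes_def Ext1_def by blast
qed

lemma Hom_S_shift_up_V:
  assumes A: "A \<in> S" and W: "W \<in> shift_up C V"
  shows "Hom C A W = {Zero C A W}"
proof -
  obtain B where B: "B \<in> V" "iso_objects C W (ShO C B)" using W unfolding shift_up_def by blast
  then have "Hom C A (ShO C B) = {Zero C A (ShO C B)}"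
    using Ext1_S_V A unfolding Ext1_vanishes_def Ext1_def by blast
  then show ?thesis using iso_Hom_zero_right iso_objects_sym B(2) S_N[OF A] N_Obj by blast
qed

lemma Hom_shift_down_S_iff:
  assumes A: "A \<in> Obj C"
  shows "(\<forall>B \<in> shift_down C S. Hom C B A = {Zero C B A}) \<longleftrightarrow>
    (\<forall>S0 \<in> S. Hom C S0 (ShO C A) = {Zero C S0 (ShO C A)})"
proof (intro iffI ballI)
  fix S0 assume l: "\<forall>B \<in> shift_down C S. Hom C B A = {Zero C B A}" and S0: "S0 \<in> S"
  obtain B \<phi> where B: "B \<in> Obj C" "is_iso C (ShO C B) S0 \<phi>"
    using ShO_ess_surj[OF N_Obj[OF S_N[OF S0]]] .
  then have i: "iso_objects C (ShO C B) S0" unfolding iso_objects_def by blast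
  then have "B \<in> shift_down C S" unfolding shift_down_def using S0 B by blast
  then show "Hom C S0 (ShO C A) = {Zero C S0 (ShO C A)}"
    using iso_Hom_zero_left[OF i ShO_Obj[OF A]] Hom_zero_ShO[OF B(1) A] l by blast
next
  fix B assume r: "\<forall>S0 \<in> S. Hom C S0 (ShO C A) = {Zero C S0 (ShO C A)}"
    and "B \<in> shift_down C S"
  then obtain S0 where B: "B \<in> Obj C" "S0 \<in> S" "iso_objects C (ShO C B) S0"
    unfolding shift_down_def by blast
  then show "Hom C B A = {Zero C B A}"
    using iso_Hom_zero_left[OF iso_objects_sym[OF B(3)] ShO_Obj[OF A]] Hom_zero_ShO[OF B(1) A] r
    by blast
qed

text \<open>
  If \<open>A\<close> has no nonzero maps to \<open>V[1]\<close>, its decomposition triangle \<open>X \<rightarrow> A \<rightarrow> W\<close> splits, and \<open>A\<close> is a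
  summand of \<open>X \<in> S\<close>.
\<close>

lemma S_iff_orthogonal:
  assumes A: "A \<in> N"
  shows "A \<in> S \<longleftrightarrow> (\<forall>W \<in> shift_up C V. Hom C A W = {Zero C A W})"
proof
  assume o: "\<forall>W \<in> shift_up C V. Hom C A W = {Zero C A W}"
  obtain S0 W f g h where S0: "S0 \<in> S" and W: "W \<in> shift_up C V" and t: "Dist C S0 A W f g h"
    using N_decomposition[OF A] .
  note IA = Id_Hom[OF N_Obj[OF A]] and g = Dist_Hom(2)[OF t]
  have "g \<bullet> Id C A = Zero C A W" using Id_right[OF g] g o W by simp
  then obtain s where s: "s \<in> Hom C A S0" "f \<bullet> s = Id C A" using Dist_lift[OF t IA] by blast
  obtain B q k where "Dist C A S0 B s q k" using TR1_cone[OF s(1)] by blast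
  then have "is_biproduct C A B S0" using split_mono_biproduct Dist_Hom(1)[OF t] s(2) by blast
  then show "A \<in> S" using S_additive(3) S0 unfolding closed_under_summands_def by blast
qed (use Hom_S_shift_up_V in blast)

text \<open>
  The same argument applied to a decomposition \<open>X \<rightarrow> A[1] \<rightarrow> W\<close> exhibits \<open>A[1]\<close> as a retract of some \<open>B[1]\<close> with
  \<open>B \<in> V\<close>; as the shift is fully faithful, \<open>A\<close> is a retract of \<open>B\<close>.
\<close>

lemma V_iff_orthogonal:
  assumes A: "A \<in> N"
  shows "A \<in> V \<longleftrightarrow> (\<forall>B \<in> shift_down C S. Hom C B A = {Zero C B A})"
proof
  assume "A \<in> V"
  then show "\<forall>B \<in> shift_down C S. Hom C B A = {Zero C B A}"
    using Hom_shift_down_S_iff[OF N_Obj[OF A]] Ext1_S_V unfolding Ext1_vanishes_def Ext1_def by blast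
next
  note AO = N_Obj[OF A]
  assume "\<forall>B \<in> shift_down C S. Hom C B A = {Zero C B A}"
  then have o: "\<forall>S0 \<in> S. Hom C S0 (ShO C A) = {Zero C S0 (ShO C A)}"
    using Hom_shift_down_S_iff[OF AO] by blast
  have sA: "ShO C A \<in> N" using N_ShO_iff[OF AO] A by blast
  obtain S0 W f g h where S0: "S0 \<in> S" and W: "W \<in> shift_up C V"
    and t: "Dist C S0 (ShO C A) W f g h"
    using N_decomposition[OF sA] .
  note IA = Id_Hom[OF N_Obj[OF sA]] and f = Dist_Hom(1)[OF t] and g = Dist_Hom(2)[OF t]
  have "Id C (ShO C A) \<bullet> f = Zero C S0 (ShO C A)" using Id_left[OF f] f o S0 by simp
  then obtain r where r: "r \<in> Hom C W (ShO C A)" "r \<bullet> g = Id C (ShO C A)"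
    using Dist_extend[OF t IA] by blast
  obtain B \<phi> where B: "B \<in> V" and \<phi>: "is_iso C W (ShO C B) \<phi>"
    using W unfolding shift_up_def iso_objects_def by blast
  obtain \<psi> where \<psi>: "\<psi> \<in> Hom C (ShO C B) W" "\<psi> \<bullet> \<phi> = Id C W"
    using \<phi> unfolding is_iso_def by blast
  note BO = N_Obj[OF V_N[OF B]] and \<phi>h = is_iso_Hom[OF \<phi>]
  note rp = Comp_Hom[OF \<psi>(1) r(1)] and pg = Comp_Hom[OF g \<phi>h]
  obtain i where i: "i \<in> Hom C A B" "ShM C i = \<phi> \<bullet> g" using ShM_full[OF pg AO BO] .
  obtain p where p: "p \<in> Hom C B A" "ShM C p = r \<bullet> \<psi>" using ShM_full[OF rp BO AO] .
  have "r \<bullet> \<psi> \<bullet> (\<phi> \<bullet> g) = r \<bullet> (\<psi> \<bullet> \<phi> \<bullet> g)"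
    using Comp_assoc[OF pg \<psi>(1) r(1)] Comp_assoc[OF g \<phi>h \<psi>(1)] by simp
  then have "ShM C (p \<bullet> i) = ShM C (Id C A)"
    using ShM_Comp[OF i(1) p(1)] i(2) p(2) \<psi>(2) Id_left[OF g] r(2) ShM_Id[OF AO] by simp
  then have pi: "p \<bullet> i = Id C A" by (rule ShM_inj[OF Comp_Hom[OF i(1) p(1)] Id_Hom[OF AO]])
  obtain E q k where "Dist C A B E i q k" using TR1_cone[OF i(1)] by blast
  then have "is_biproduct C A E B" using split_mono_biproduct p(1) pi by blast
  then show "A \<in> V" using V_additive(3) B unfolding closed_under_summands_def by blast
qed

lemma preimage_S_eq: "{A \<in> Obj C. FO iL A \<in> S} = left_orthogonal C (shift_up C V)"
  using S_iff_orthogonal[OF iL_N] Hom_zero_reflection shift_up_V_N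
  unfolding left_orthogonal_def by blast

lemma preimage_V_eq: "{A \<in> Obj C. FO iR A \<in> V} = right_orthogonal C (shift_down C S)"
  using V_iff_orthogonal[OF iR_N] Hom_zero_coreflection shift_down_S_N
  unfolding right_orthogonal_def by blast

text \<open>
  The octahedron on \<open>X \<rightarrow> i\<^sup>!A \<rightarrow> A\<close>, where \<open>X\<close> is the \<open>S\<close>-part of \<open>i\<^sup>!A\<close>.
\<close>

lemma decomposition_S_T:
  assumes A: "A \<in> Obj C"
  shows "A \<in> star C S (shift_up C (right_orthogonal C (shift_down C S)))"
proof -
  let ?j = "FO jR (FO (quotient_functor C N) A)"
  obtain k where tA: "Dist C (FO iR A) A ?j (\<epsilon>_iR A) (\<eta>_jR A) k"
    using triangle_iR_jR[OF A] by auto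
  obtain S0 W f g h where S0: "S0 \<in> S" and W: "W \<in> shift_up C V"
    and t: "Dist C S0 (FO iR A) W f g h"
    using N_decomposition[OF iR_N[OF A]] .
  obtain Y f' f'' where tY: "Dist C S0 A Y (\<epsilon>_iR A \<bullet> f) f' f''"
    using TR1_cone[OF Comp_Hom[OF Dist_Hom(1)[OF t] Dist_Hom(1)[OF tA]]] by blast
  obtain u v w where oct: "Dist C W Y ?j u v w" using TR4[OF t tA tY] by blast
  have Y0: "Hom C X Y = {Zero C X Y}" if X: "X \<in> S" for X
    using Dist_Hom_zero_middle_right[OF oct N_Obj[OF S_N[OF X]] Hom_S_shift_up_V[OF X W]
        Hom_N_jR_zero[OF S_N[OF X] quotient_Obj[OF A]]] .
  obtain T0 \<phi> where T0: "T0 \<in> Obj C" "is_iso C (ShO C T0) Y \<phi>"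
    using ShO_ess_surj[OF Dist_Obj(3)[OF tY]] .
  then have i: "iso_objects C Y (ShO C T0)" using iso_objects_sym unfolding iso_objects_def by blast
  have "Hom C X (ShO C T0) = {Zero C X (ShO C T0)}" if X: "X \<in> S" for X
    using iso_Hom_zero_right[OF i N_Obj[OF S_N[OF X]] Y0[OF X]] .
  then have "T0 \<in> right_orthogonal C (shift_down C S)"
    using Hom_shift_down_S_iff[OF T0(1)] T0(1) unfolding right_orthogonal_def by blast
  then have "Y \<in> shift_up C (right_orthogonal C (shift_down C S))"
    using i Dist_Obj(3)[OF tY] unfolding shift_up_def by blast
  then show ?thesis using tY S0 A unfolding star_def by blast
qed

text \<open>
  The octahedron on \<open>A \<rightarrow> i\<^sup>*A \<rightarrow> W\<close>, where \<open>W\<close> is the \<open>V[1]\<close>-part of \<open>i\<^sup>*A\<close>.  It relates cones rather than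
  cocones, so it yields the triangle \<open>j\<^sub>!\<ell>A \<rightarrow> U \<rightarrow> X\<close> only after one shift, and orthogonality to \<open>V[1]\<close> is
  tested there.
\<close>

lemma decomposition_U_V:
  assumes A: "A \<in> Obj C"
  shows "A \<in> star C (left_orthogonal C (shift_up C V)) (shift_up C V)"
proof -
  let ?j = "FO jL (FO (quotient_functor C N) A)"
  obtain k where tA: "Dist C ?j A (FO iL A) (\<epsilon>_jL A) (\<eta>_iL A) k"
    using triangle_jL_iL[OF A] by auto
  obtain S0 W f g h where S0: "S0 \<in> S" and W: "W \<in> shift_up C V"
    and t: "Dist C S0 (FO iL A) W f g h"
    using N_decomposition[OF iL_N[OF A]] .
  obtain U0 f' h' where tU: "Dist C U0 A W f' (g \<bullet> \<eta>_iL A) h'"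
    using Dist_cocone[OF Comp_Hom[OF Dist_Hom(2)[OF tA] Dist_Hom(2)[OF t]]] .
  note U0 = Dist_Obj(1)[OF tU] and S0O = Dist_Obj(1)[OF t] and jO = Dist_Obj(1)[OF tA]
  obtain u v w where oct: "Dist C (ShO C ?j) (ShO C U0) (ShO C S0) u v w"
    using TR4[OF Dist_rotate[OF tA] Dist_rotate[OF t] Dist_rotate[OF tU]] by blast
  have "Hom C U0 E = {Zero C U0 E}" if E: "E \<in> shift_up C V" for E
  proof -
    note EN = shift_up_V_N[OF E] and EO = N_Obj[OF shift_up_V_N[OF E]]
    have "Hom C (ShO C ?j) (ShO C E) = {Zero C (ShO C ?j) (ShO C E)}"
      using Hom_zero_ShO[OF jO EO] Hom_jL_N_zero[OF EN quotient_Obj[OF A]] by blast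
    moreover have "Hom C (ShO C S0) (ShO C E) = {Zero C (ShO C S0) (ShO C E)}"
      using Hom_zero_ShO[OF S0O EO] Hom_S_shift_up_V[OF S0 E] by blast
    ultimately have "Hom C (ShO C U0) (ShO C E) = {Zero C (ShO C U0) (ShO C E)}"
      using Dist_Hom_zero_middle_left[OF oct ShO_Obj[OF EO]] by blast
    then show ?thesis using Hom_zero_ShO[OF U0 EO] by blast
  qed
  then have "U0 \<in> left_orthogonal C (shift_up C V)" using U0 unfolding left_orthogonal_def by blast
  then show ?thesis using tU W A unfolding star_def by blast
qed

lemma star_S_V1_eq_N: "star C S (shift_up C V) = N"
proof
  show "star C S (shift_up C V) \<subseteq> N"
    unfolding star_def by (auto intro: N_extension S_N shift_up_V_N)
  show "N \<subseteq> star C S (shift_up C V)"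
  proof
    fix A assume A: "A \<in> N"
    obtain S0 W f g h where "S0 \<in> S" "W \<in> shift_up C V" "Dist C S0 A W f g h"
      using N_decomposition[OF A] .
    then show "A \<in> star C S (shift_up C V)" using N_Obj[OF A] unfolding star_def by blast
  qed
qed

text \<open>
  Decomposing \<open>A[1]\<close> and removing the shift gives the decomposition of \<open>A\<close> with first term in \<open>S[-1]\<close>.
\<close>

lemma star_S1_V_eq_N: "star C (shift_down C S) V = N"
proof
  show "star C (shift_down C S) V \<subseteq> N"
    unfolding star_def by (auto intro: N_extension V_N shift_down_S_N)
  show "N \<subseteq> star C (shift_down C S) V"
  proof
    fix A assume A: "A \<in> N"
    note AO = N_Obj[OF A]
    have "ShO C A \<in> N" using A N_ShO_iff[OF AO] by blast
    then obtain S0 W f g h where S0: "S0 \<in> S" and W: "W \<in> shift_up C V"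
      and t: "Dist C S0 (ShO C A) W f g h"
      using N_decomposition[OF \<open>ShO C A \<in> N\<close>] by blast
    obtain B \<psi> where B: "B \<in> V" and \<psi>: "is_iso C (ShO C B) W \<psi>"
      using W iso_objects_sym unfolding shift_up_def iso_objects_def by blast
    obtain E \<phi> where E: "E \<in> Obj C" and \<phi>: "is_iso C (ShO C E) S0 \<phi>"
      using ShO_ess_surj[OF Dist_Obj(1)[OF t]] .
    obtain f' g' h' where "Dist C (ShO C E) (ShO C A) (ShO C B) f' g' h'"
      using Dist_iso_ends[OF t \<phi> \<psi>] .
    then obtain f'' g'' h'' where "Dist C E A B f'' g'' h''"
      using Dist_unshift[OF _ E AO N_Obj[OF V_N[OF B]]] by metis
    moreover have "E \<in> shift_down C S"
      unfolding shift_down_def iso_objects_def using E S0 \<phi> by blast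
    ultimately show "A \<in> star C (shift_down C S) V" using AO B unfolding star_def by blast
  qed
qed

lemma cotorsion_pair_S_T: "cotorsion_pair C (S, right_orthogonal C (shift_down C S))"
proof -
  have sub: "shift_down C S \<subseteq> Obj C" unfolding shift_down_def by blast
  have "Obj C = star C S (shift_up C (right_orthogonal C (shift_down C S)))"
    using decomposition_S_T by (auto simp: star_def)
  moreover have "Ext1_vanishes C S (right_orthogonal C (shift_down C S))"
    using Hom_shift_down_S_iff unfolding Ext1_vanishes_def Ext1_def right_orthogonal_def by blast
  ultimately show ?thesis
    unfolding cotorsion_pair_def using S_additive right_orthogonal_additive[OF sub] by simp
qed

lemma cotorsion_pair_U_V: "cotorsion_pair C (left_orthogonal C (shift_up C V), V)"
proof -
  have sub: "shift_up C V \<subseteq> Obj C" unfolding shift_up_def by blast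
  have "Obj C = star C (left_orthogonal C (shift_up C V)) (shift_up C V)"
    using decomposition_U_V by (auto simp: star_def)
  moreover have "ShO C B \<in> shift_up C V" if "B \<in> V" for B
    using that iso_objects_refl ShO_Obj N_Obj V_N unfolding shift_up_def by blast
  then have "Ext1_vanishes C (left_orthogonal C (shift_up C V)) V"
    unfolding Ext1_vanishes_def Ext1_def left_orthogonal_def by blast
  ultimately show ?thesis
    unfolding cotorsion_pair_def using V_additive left_orthogonal_additive[OF sub] by simp
qed

lemma Hovey_TCP_orthogonals:
  "Hovey_TCP C ((S, right_orthogonal C (shift_down C S)), (left_orthogonal C (shift_up C V), V))"
  unfolding Hovey_TCP_def twin_cotorsion_pair_def
  using cotorsion_pair_S_T cotorsion_pair_U_V Ext1_S_V star_S_V1_eq_N star_S1_V_eq_N by simp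

end

theorem corollary6p20:
  fixes C :: "('o, 'm, 'z) tri_category_scheme"
    and N S V U T :: "'o set"
    and iL iR :: "('o, 'm, 'o, 'm) ftor"
    and jL jR :: "('o, ('o, 'm) roof set, 'o, 'm) ftor"
    and \<eta>_iL \<epsilon>_iL \<eta>_iR \<epsilon>_iR \<epsilon>_jL \<eta>_jR :: "'o \<Rightarrow> 'm"
    and \<eta>_jL \<epsilon>_jR :: "'o \<Rightarrow> ('o, 'm) roof set"
  assumes "recollement C N iL iR jL jR \<eta>_iL \<epsilon>_iL \<eta>_iR \<epsilon>_iR \<eta>_jL \<epsilon>_jL \<eta>_jR \<epsilon>_jR"
    and "cotorsion_pair (full_subcategory C N) (S, V)"
    and "U = {A \<in> Obj C. FO iL A \<in> S}"
    and "T = {A \<in> Obj C. FO iR A \<in> V}"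
  shows "Hovey_TCP C ((S, T), (U, V)) \<and>
         U = left_orthogonal C (shift_up C V) \<and>
         T = right_orthogonal C (shift_down C S)"
proof -
  interpret recollement_with_cotorsion_pair C N iL iR jL jR \<eta>_iL \<epsilon>_iL \<eta>_iR \<epsilon>_iR
    \<eta>_jL \<epsilon>_jL \<eta>_jR \<epsilon>_jR S V
    using assms(1,2)
    by (intro recollement_with_cotorsion_pair.intro recollement_with_cotorsion_pair_axioms.intro)
  show ?thesis using assms(3,4) preimage_S_eq preimage_V_eq Hovey_TCP_orthogonals by simp
qed

end
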